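(* Let $n\ge1$ and let $f\in\mathbf{k}[x_1,\dots,x_n]$ be homogeneous of degree $n-1$. Suppose $f=g+h$ with $g\in L_n$ and $h\in\mathrm{QSym}_n^+$. Then $$\langle f\rangle_n^q=g(1,q,q^2,\dots,q^{n-1}).$$ In particular, for $c\in\mathrm{ABB}_n$ with $|c|=n-1$, $\langle x_1^{c_1}\cdots x_n^{c_n}\rangle_n^q=q^{\sum_{i=1}^n(i-1)c_i}$.
   Context: Let $\mathbf{k}$ be a field of characteristic zero and $q\in\mathbf{k}$ not a nontrivial root of unity. $\mathrm{QSym}_n^+$ is the ideal of $\mathbf{k}[x_1,\dots,x_n]$ generated by quasisymmetric polynomials in $x_1,\dots,x_n$ without constant term. $\mathrm{ABB}_n=\{(c_1,\dots,c_n)\in\mathbb{N}^n:\sum_{j=i}^nc_j\le n-i\text{ for all }1\le i\le n\}$, and $L_n$ is the $\mathbf{k}$-span of the monomials $x_1^{c_1}\cdots x_n^{c_n}$ with $c\in\mathrm{ABB}_n$. For $1\le j\le n-1$, $s_j$ swaps $x_j,x_{j+1}$, $\partial_j g=(g-s_jg)/(x_j-x_{j+1})$, $T_j(g)=(q-1)\partial_j(x_jg)+s_jg$; $T_w=T_{j_1}\cdots T_{j_\ell}$ for a reduced word of $w\in S_n$; $\langle f\rangle_n^q=\sum_{w\in S_n}T_w\big(f/\prod_{j=1}^{n-1}(qx_j-x_{j+1})\big)$. *)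

theory Defs
  imports "HOL-Library.Poly_Mapping" "HOL-Computational_Algebra.Fraction_Field"
          "HOL-Combinatorics.Permutations"
begin

text \<open>Multivariate polynomials over 'k in the variables x_1, x_2, ... (indexed by positive
naturals): finitely supported maps from exponent vectors (nat =>0 nat) to coefficients.
A polynomial lies in k[x_1,...,x_n] iff all monomials in its support only involve
variables with index in {1..n}.  Rational functions are the fraction field.\<close>

type_synonym 'k mpoly = "(nat \<Rightarrow>\<^sub>0 nat) \<Rightarrow>\<^sub>0 'k"

definition Var :: "nat \<Rightarrow> 'k::comm_ring_1 mpoly" where
  "Var i = Poly_Mapping.single (Poly_Mapping.single i 1) 1"

definition in_vars :: "nat \<Rightarrow> 'k::zero mpoly \<Rightarrow> bool" where
  "in_vars n p \<longleftrightarrow> (\<forall>m\<in>Poly_Mapping.keys p. Poly_Mapping.keys m \<subseteq> {1..n})"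

definition total_deg :: "(nat \<Rightarrow>\<^sub>0 nat) \<Rightarrow> nat" where
  "total_deg m = (\<Sum>i\<in>Poly_Mapping.keys m. Poly_Mapping.lookup m i)"

definition homogeneous :: "nat \<Rightarrow> 'k::zero mpoly \<Rightarrow> bool" where
  "homogeneous d p \<longleftrightarrow> (\<forall>m\<in>Poly_Mapping.keys p. total_deg m = d)"

definition ABB :: "nat \<Rightarrow> (nat \<Rightarrow>\<^sub>0 nat) set" where
  "ABB n = {c. Poly_Mapping.keys c \<subseteq> {1..n} \<and>
              (\<forall>i\<in>{1..n}. (\<Sum>j=i..n. Poly_Mapping.lookup c j) \<le> n - i)}"

definition L_space :: "nat \<Rightarrow> 'k::zero mpoly set" where
  "L_space n = {g. Poly_Mapping.keys g \<subseteq> ABB n}"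

definition exp_seq :: "(nat \<Rightarrow>\<^sub>0 nat) \<Rightarrow> nat list" where
  "exp_seq m = map (Poly_Mapping.lookup m) (sorted_list_of_set (Poly_Mapping.keys m))"

definition quasisym :: "nat \<Rightarrow> 'k::zero mpoly \<Rightarrow> bool" where
  "quasisym n p \<longleftrightarrow> in_vars n p \<and>
     (\<forall>m m'. Poly_Mapping.keys m \<subseteq> {1..n} \<longrightarrow> Poly_Mapping.keys m' \<subseteq> {1..n} \<longrightarrow>
        exp_seq m = exp_seq m' \<longrightarrow> Poly_Mapping.lookup p m = Poly_Mapping.lookup p m')"

inductive_set QSym_plus_ideal :: "nat \<Rightarrow> 'k::comm_ring_1 mpoly set" for n where
  zero: "0 \<in> QSym_plus_ideal n"
| add: "h1 \<in> QSym_plus_ideal n \<Longrightarrow> h2 \<in> QSym_plus_ideal n \<Longrightarrow> h1 + h2 \<in> QSym_plus_ideal n"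
| gen: "in_vars n a \<Longrightarrow> quasisym n p \<Longrightarrow> Poly_Mapping.lookup p 0 = 0 \<Longrightarrow>
        a * p \<in> QSym_plus_ideal n"

definition eval_mpoly :: "(nat \<Rightarrow> 'k::comm_ring_1) \<Rightarrow> 'k mpoly \<Rightarrow> 'k" where
  "eval_mpoly a p = (\<Sum>m\<in>Poly_Mapping.keys p. Poly_Mapping.lookup p m *
      (\<Prod>i\<in>Poly_Mapping.keys m. a i ^ Poly_Mapping.lookup m i))"

definition swp :: "nat \<Rightarrow> nat \<Rightarrow> nat" where
  "swp j i = (if i = j then j + 1 else if i = j + 1 then j else i)"

definition swap_poly :: "nat \<Rightarrow> 'k::zero mpoly \<Rightarrow> 'k mpoly" where
  "swap_poly j p = Poly_Mapping.map_key (\<lambda>m. Poly_Mapping.map_key (swp j) m) p"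

text \<open>Extension of s_j to rational functions (well defined since s_j is a ring automorphism).\<close>
definition swap_fract :: "nat \<Rightarrow> 'k::idom mpoly fract \<Rightarrow> 'k mpoly fract" where
  "swap_fract j F = (SOME G. \<forall>a b. b \<noteq> 0 \<longrightarrow> F = Fract a b \<longrightarrow>
        G = Fract (swap_poly j a) (swap_poly j b))"

definition to_fract :: "'k::idom mpoly \<Rightarrow> 'k mpoly fract" where
  "to_fract p = Fract p 1"

definition ddiff :: "nat \<Rightarrow> 'k::field mpoly fract \<Rightarrow> 'k mpoly fract" where
  "ddiff j G = (G - swap_fract j G) / to_fract (Var j - Var (j + 1))"

definition T_op :: "'k::field \<Rightarrow> nat \<Rightarrow> 'k mpoly fract \<Rightarrow> 'k mpoly fract" where
  "T_op q j G = to_fract (Poly_Mapping.single 0 (q - 1)) * ddiff j (to_fract (Var j) * G)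
                + swap_fract j G"

definition word_perm :: "nat list \<Rightarrow> nat \<Rightarrow> nat" where
  "word_perm ws = foldr (\<lambda>j \<sigma>. swp j \<circ> \<sigma>) ws id"

definition reduced_word :: "nat \<Rightarrow> (nat \<Rightarrow> nat) \<Rightarrow> nat list \<Rightarrow> bool" where
  "reduced_word n w ws \<longleftrightarrow> set ws \<subseteq> {1..n-1} \<and> word_perm ws = w \<and>
     (\<forall>vs. set vs \<subseteq> {1..n-1} \<longrightarrow> word_perm vs = w \<longrightarrow> length ws \<le> length vs)"

fun T_word :: "'k::field \<Rightarrow> nat list \<Rightarrow> 'k mpoly fract \<Rightarrow> 'k mpoly fract" where
  "T_word q [] G = G"
| "T_word q (j # ws) G = T_op q j (T_word q ws G)"

definition T_perm :: "'k::field \<Rightarrow> nat \<Rightarrow> (nat \<Rightarrow> nat) \<Rightarrow> 'k mpoly fract \<Rightarrow> 'k mpoly fract" where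
  "T_perm q n w = T_word q (SOME ws. reduced_word n w ws)"

definition bracket :: "'k::field \<Rightarrow> nat \<Rightarrow> 'k mpoly \<Rightarrow> 'k mpoly fract" where
  "bracket q n f = (\<Sum>w\<in>{w. w permutes {1..n}}.
      T_perm q n w (to_fract f /
        to_fract (\<Prod>j=1..n-1. Poly_Mapping.single 0 q * Var j - Var (j + 1))))"

end

(* For a product of polynomials in the first i and in the last n - i variables, the factor
   q x_i - x_{i+1} cancels one denominator, so that the Hecke symmetrizer of S_n factors through
   that of S_i x S_{n-i}:
     <(q x_i - x_{i+1}) u v>_n = [n choose i]_q <u>_i <v>_{n-i}.
   Together with <(x_1 + ... + x_n) u>_n = (x_1 + ... + x_n) <u>_n = 0 for deg u < n - 1 these
   relations determine <.>_n by induction on n, because [n]_q is nonzero.  The functional psi given by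
   the recursion
     psi_n(f) = sum_i q^(i-1) psi_{n-1}(R_i f),
     R_i f = (f(..., x_{i-1}, x_i, 0, x_{i+1}, ...) - f(..., x_{i-1}, 0, x_i, x_{i+1}, ...)) / x_i,
   satisfies the same relations, hence equals <.>_n.  The operators R_i annihilate quasisymmetric
   polynomials and obey a Leibniz rule, so psi vanishes on the ideal QSym_n^+.  On an ABB monomial
   of degree n - 1 the right-hand side of the first relation vanishes for every move of a variable
   x_{i+1} to x_i, and such moves lead to x_1^(n-1), where psi is 1.

   The components of g of degree d < n - 1 lie in QSym_n^+ and are treated by multiplying them
   with x_1^(n-1-d), which stays within ABB. *)

theory Submission
  imports Defs
begin

text \<open>The bracket picks an arbitrary reduced word for each w, so independence of that choice
  has to come before any computation with it. The next obstacle is that <u>_n vanishes when deg u <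
  n - 1, on which the second relation rests. A degree count would give this at once if <u>_n were
  known to be a polynomial, but the symmetrizer acts on rational functions. Instead only <1>_n = 0
  (n >= 2) is proved directly; the higher degrees then come out of the same induction that compares
  the bracket with psi.

  The relations determine the bracket for the following reason. For fixed u let d_i be the
  difference of the two functionals at x_i u. Both satisfy the same first relation, so d_(i+1) = q
  d_i, and the d_i sum to 0. The sum is also [n]_q d_1, hence all d_i vanish.

  The condition on q is used in the form [k]_q nonzero for k >= 1: if [k]_q = 0 then q^k = 1, so q =
  1, where [k]_1 = k is nonzero in characteristic zero.\<close>

section \<open>Reduced words in the symmetric group\<close>

text \<open>Inversions are pairs of values rather than positions: right multiplication by a simple
  transposition then adds or removes a single pair.\<close>

definition invs :: "(nat \<Rightarrow> nat) \<Rightarrow> (nat \<times> nat) set" where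
  "invs w = {(u, v). u < v \<and> inv w v < inv w u}"

definition len :: "(nat \<Rightarrow> nat) \<Rightarrow> nat" where
  "len w = card (invs w)"

lemma swp_swp [simp]: "swp j (swp j i) = i"
  by (auto simp: swp_def)

lemma comp_swp_swp [simp]: "w \<circ> swp j \<circ> swp j = w"
  by (auto simp: fun_eq_iff)

lemma bij_swp [simp]: "bij (swp j)"
  by (rule o_bij[of "swp j"]) auto

lemma inv_swp [simp]: "inv (swp j) = swp j"
  by (rule inv_unique_comp) auto

lemma swp_permutes: "1 \<le> j \<Longrightarrow> j < n \<Longrightarrow> swp j permutes {1..n}"
  by (rule inj_imp_permutes) (auto simp: swp_def inj_on_def)

lemma comp_swp_permutes:
  assumes "w permutes {1..n}" "1 \<le> j" "j < n"
  shows "w \<circ> swp j permutes {1..n}"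
  using permutes_compose[OF swp_permutes[OF assms(2,3)] assms(1)] .

lemma word_perm_Nil [simp]: "word_perm [] = id"
  by (simp add: word_perm_def)

lemma word_perm_Cons: "word_perm (j # ws) = swp j \<circ> word_perm ws"
  by (simp add: word_perm_def)

lemma word_perm_append: "word_perm (us @ vs) = word_perm us \<circ> word_perm vs"
  by (induction us) (auto simp: word_perm_Cons o_assoc)

lemma word_perm_snoc [simp]: "word_perm (ws @ [j]) = word_perm ws \<circ> swp j"
  by (simp only: word_perm_append word_perm_Cons word_perm_Nil comp_id)

lemma word_perm_permutes: "set ws \<subseteq> {1..n-1} \<Longrightarrow> word_perm ws permutes {1..n}"
proof (induction ws)
  case (Cons j ws)
  then have "swp j permutes {1..n}" by (intro swp_permutes) auto
  moreover have "word_perm ws permutes {1..n}" using Cons by auto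
  ultimately show ?case unfolding word_perm_Cons by (metis permutes_compose)
qed (simp add: permutes_id)

lemma finite_invs:
  assumes "w permutes {1..n}"
  shows "finite (invs w)"
proof (rule finite_subset)
  let ?W = "inv w"
  have W: "?W permutes {1..n}" using assms by (rule permutes_inv)
  have out: "?W u = u" if "u \<notin> {1..n}" for u using W that by (rule permutes_not_in)
  have inn: "?W u \<in> {1..n} \<longleftrightarrow> u \<in> {1..n}" for u using W by (rule permutes_in_image)
  show "invs w \<subseteq> {1..n} \<times> {1..n}"
  proof
    fix p assume "p \<in> invs w"
    then obtain u v where p: "p = (u, v)" and uv: "u < v" "?W v < ?W u" by (auto simp: invs_def)
    show "p \<in> {1..n} \<times> {1..n}"
      unfolding p using uv out[of u] out[of v] inn[of u] inn[of v] by (cases "u \<in> {1..n}"; cases "v \<in> {1..n}") auto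
  qed
qed auto

lemma invs_ascent:
  assumes w: "bij w" and asc: "w j < w (j + 1)"
  shows "invs (w \<circ> swp j) = insert (w j, w (j + 1)) (invs w)" "(w j, w (j + 1)) \<notin> invs w"
proof -
  let ?W = "inv w"
  have Ww [simp]: "?W (w x) = x" for x using w by (simp add: bij_is_inj)
  have wW: "w (?W x) = x" for x using w by (simp add: bij_is_surj surj_f_inv_f)
  have inv: "inv (w \<circ> swp j) = swp j \<circ> ?W"
    using w by (subst o_inv_distrib) auto
  have key: "swp j (?W v) < swp j (?W u) \<longleftrightarrow> ?W v < ?W u \<or> (u = w j \<and> v = w (j + 1))"
    if uv: "u < v" for u v
  proof -
    have ne: "?W u \<noteq> ?W v" using uv wW by (metis less_irrefl)
    consider "?W u = j" "?W v = j + 1" | "?W u = j + 1" "?W v = j"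
      | "\<not> (?W u = j \<and> ?W v = j + 1)" "\<not> (?W u = j + 1 \<and> ?W v = j)" by blast
    then show ?thesis
    proof cases
      case 1
      then have "u = w j" "v = w (j + 1)" using wW by metis+
      with 1 show ?thesis by (simp add: swp_def)
    next
      case 2
      then have "u = w (j + 1)" "v = w j" using wW by metis+
      with asc uv show ?thesis by simp
    next
      case 3
      then have "\<not> (u = w j \<and> v = w (j + 1))" by auto
      moreover have "swp j (?W v) < swp j (?W u) \<longleftrightarrow> ?W v < ?W u"
        using 3 ne by (auto simp: swp_def)
      ultimately show ?thesis by blast
    qed
  qed
  show "invs (w \<circ> swp j) = insert (w j, w (j + 1)) (invs w)"
    using key asc by (auto simp: invs_def inv)
  show "(w j, w (j + 1)) \<notin> invs w" by (simp add: invs_def)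
qed

lemma len_ascent:
  assumes "w permutes {1..n}" "w j < w (j + 1)"
  shows "len (w \<circ> swp j) = len w + 1"
  using invs_ascent[OF permutes_bij[OF assms(1)] assms(2)] finite_invs[OF assms(1)]
  by (simp add: len_def)

lemma len_descent:
  assumes w: "w permutes {1..n}" and "1 \<le> j" "j < n" and desc: "w (j + 1) < w j"
  shows "len w = len (w \<circ> swp j) + 1"
  using len_ascent[OF comp_swp_permutes[OF assms(1-3)], of j] desc
  by (simp add: swp_def)

lemma permutes_neq: "(w :: nat \<Rightarrow> nat) permutes S \<Longrightarrow> i \<noteq> j \<Longrightarrow> w i \<noteq> w j"
  by (meson permutes_inj injD)

lemma len_comp_swp_le:
  assumes w: "w permutes {1..n}" and "1 \<le> j" "j < n"
  shows "len (w \<circ> swp j) \<le> len w + 1"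
proof -
  have "w j \<noteq> w (j + 1)" using w by (simp add: permutes_neq)
  then consider "w j < w (j + 1)" | "w (j + 1) < w j" by linarith
  then show ?thesis using len_ascent[OF w] len_descent[OF assms] by cases auto
qed

lemma len_id [simp]: "len id = 0"
proof -
  have "invs id = {}" by (auto simp: invs_def)
  then show ?thesis by (simp add: len_def)
qed

lemma len_word_perm_le: "set ws \<subseteq> {1..n-1} \<Longrightarrow> len (word_perm ws) \<le> length ws"
proof (induction ws rule: rev_induct)
  case (snoc j ws)
  then have "len (word_perm ws \<circ> swp j) \<le> len (word_perm ws) + 1"
    by (intro len_comp_swp_le[OF word_perm_permutes]) auto
  moreover have "len (word_perm ws) \<le> length ws" using snoc by auto
    moreover have "len (word_perm (ws @ [j])) = len (word_perm ws \<circ> swp j)"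
    by (rule arg_cong[OF word_perm_snoc])
  ultimately have "len (word_perm (ws @ [j])) \<le> length (ws @ [j])" by (simp del: word_perm_snoc)
  then show ?case .
qed simp

text \<open>Ascending from a value at least 1 keeps w on or above the diagonal; descending from a
  value at most n keeps it on or below.\<close>

lemma ascending_permutes_id:
  assumes w: "w permutes {1..n}" and asc: "\<And>j::nat. 1 \<le> j \<Longrightarrow> j < n \<Longrightarrow> w j < w (j + 1)"
  shows "w = id"
proof -
  have inn: "w i \<in> {1..n}" if "i \<in> {1..n}" for i using w that by (simp only: permutes_in_image)
  have ge: "1 \<le> i \<Longrightarrow> i \<le> n \<Longrightarrow> i \<le> w i" for i :: nat
  proof (induction i rule: nat_induct_at_least)
    case base
    then show ?case using inn[of 1] by auto
  next
    case (Suc i)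
    then show ?case using asc[of i] by simp
  qed
  have le: "1 \<le> i \<Longrightarrow> w i \<le> i" if "i \<le> n" for i
    using that
  proof (induction i rule: inc_induct)
    case base
    then show ?case using inn[of n] by auto
  next
    case (step i)
    then show ?case using asc[of i] by simp
  qed
  show ?thesis
  proof
    fix i show "w i = id i"
      using ge[of i] le[of i] permutes_not_in[OF w, of i] by (cases "i \<in> {1..n}") force+
  qed
qed

text \<open>Bubble sort: each descent that is removed costs one letter and one inversion, and a
  permutation without descents is the identity.\<close>

lemma ex_word:
  "w permutes {1..n} \<Longrightarrow> \<exists>ws. set ws \<subseteq> {1..n-1} \<and> word_perm ws = w \<and> length ws = len w"
proof (induction "len w" arbitrary: w rule: less_induct)
  case less
  note w = \<open>w permutes {1..n}\<close>
  show ?case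
  proof (cases "\<exists>j. 1 \<le> j \<and> j < n \<and> w (j + 1) < w j")
    case True
    then obtain j where j: "1 \<le> j" "j < n" "w (j + 1) < w j" by blast
    note l = len_descent[OF w j]
    then obtain ws where ws: "set ws \<subseteq> {1..n-1}" "word_perm ws = w \<circ> swp j" "length ws = len (w \<circ> swp j)"
      using less(1)[of "w \<circ> swp j"] comp_swp_permutes[OF w j(1,2)] by auto
    then show ?thesis using j l by (intro exI[of _ "ws @ [j]"]) auto
  next
    case False
    have "w = id"
    proof (rule ascending_permutes_id[OF w])
      fix j assume "1 \<le> j" "j < n"
      then have "\<not> w (j + 1) < w j" using False by blast
      moreover have "w j \<noteq> w (j + 1)" using w by (simp add: permutes_neq)
      ultimately show "w j < w (j + 1)" by linarith
    qed
    then show ?thesis by (intro exI[of _ "[]"]) auto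
  qed
qed

text \<open>Minimality among all words becomes an equation of lengths, which can be checked for one
  word at a time.\<close>

lemma reduced_word_iff:
  assumes "w permutes {1..n}"
  shows "reduced_word n w ws \<longleftrightarrow> set ws \<subseteq> {1..n-1} \<and> word_perm ws = w \<and> length ws = len w"
proof
  assume r: "reduced_word n w ws"
  obtain vs where "set vs \<subseteq> {1..n-1}" "word_perm vs = w" "length vs = len w"
    using ex_word[OF assms] by blast
  with r have "length ws \<le> len w" by (metis reduced_word_def)
  then show "set ws \<subseteq> {1..n-1} \<and> word_perm ws = w \<and> length ws = len w"
    using r len_word_perm_le[of ws n] by (auto simp: reduced_word_def)
next
  assume "set ws \<subseteq> {1..n-1} \<and> word_perm ws = w \<and> length ws = len w"
  then show "reduced_word n w ws" using len_word_perm_le[of _ n] by (metis reduced_word_def)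
qed

lemma ex_reduced_word: "w permutes {1..n} \<Longrightarrow> \<exists>ws. reduced_word n w ws"
  using ex_word reduced_word_iff by meson

text \<open>Matsumoto's theorem for operators that satisfy only the braid and commutation relations.
  If two reduced words of w end in j and k, then w has descents at both j and k, so both words can
  be rewritten to end in the two reduced words of the longest element of the subgroup generated by
  \<open>swp j\<close> and \<open>swp k\<close>; these agree by one relation. The rewriting takes
  place after the last letter is removed, where the induction hypothesis applies.\<close>

lemma matsumoto:
  fixes t :: "nat \<Rightarrow> 'a \<Rightarrow> 'a"
  assumes comm: "\<And>i j x. i + 1 < j \<Longrightarrow> t i (t j x) = t j (t i x)"
    and braid: "\<And>i x. t i (t (i + 1) (t i x)) = t (i + 1) (t i (t (i + 1) x))"
  shows "reduced_word n w us \<Longrightarrow> reduced_word n w vs \<Longrightarrow> w permutes {1..n} \<Longrightarrow>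
    foldr t us x = foldr t vs x"
proof (induction "length us" arbitrary: us vs w x rule: less_induct)
  case less
  note w = \<open>w permutes {1..n}\<close>
  have us: "set us \<subseteq> {1..n-1}" "word_perm us = w" "length us = len w"
    and vs: "set vs \<subseteq> {1..n-1}" "word_perm vs = w" "length vs = len w"
    using less.prems reduced_word_iff[OF w] by auto
  show ?case
  proof (cases us rule: rev_cases)
    case Nil
    with us vs show ?thesis by simp
  next
    case (snoc us' j)
    with us vs obtain vs' k where vs': "vs = vs' @ [k]" by (cases vs rule: rev_cases) auto
    have jk: "1 \<le> j" "j < n" "1 \<le> k" "k < n" using us vs snoc vs' by auto
    have last: "reduced_word n (w \<circ> swp i) ws" "w (i + 1) < w i"
      if ws: "set (ws @ [i]) \<subseteq> {1..n-1}" "word_perm (ws @ [i]) = w" "length (ws @ [i]) = len w" for ws i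
    proof -
      have i: "1 \<le> i" "i < n" using ws by auto
      have p: "word_perm ws = w \<circ> swp i" using ws(2) comp_swp_swp[of "word_perm ws" i] by simp
      have lt: "len (w \<circ> swp i) \<le> length ws"
        using len_word_perm_le[of ws n] ws p by auto
      have "w i \<noteq> w (i + 1)" using w by (simp add: permutes_neq)
      then show desc: "w (i + 1) < w i"
        using lt ws(3) len_ascent[OF w, of i] by fastforce
      show "reduced_word n (w \<circ> swp i) ws"
        using len_descent[OF w i desc] ws p
        by (auto simp: reduced_word_iff[OF comp_swp_permutes[OF w i]])
    qed
    have rj: "reduced_word n (w \<circ> swp j) us'" and dj: "w (j + 1) < w j"
      using last[of us' j] us snoc by auto
    have rk: "reduced_word n (w \<circ> swp k) vs'" and dk: "w (k + 1) < w k"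
      using last[of vs' k] vs vs' by auto
    note pj = comp_swp_permutes[OF w jk(1,2)] and pk = comp_swp_permutes[OF w jk(3,4)]
    have IH: "foldr t as y = foldr t bs y"
      if "reduced_word n v as" "reduced_word n v bs" "v permutes {1..n}" "len v < len w" for as bs v y
      using less.hyps[of as v bs y] that us by (auto simp: reduced_word_iff)
    have lj: "len w = len (w \<circ> swp j) + 1" and lk: "len w = len (w \<circ> swp k) + 1"
      using len_descent[OF w jk(1,2) dj] len_descent[OF w jk(3,4) dk] by auto
    have far: "foldr t (as @ [a]) x = foldr t (bs @ [b]) x"
      if ab: "a + 1 < b" and dom: "1 \<le> a" "b < n" and da: "w (a + 1) < w a" and db: "w (b + 1) < w b"
        and ra: "reduced_word n (w \<circ> swp a) as" and rb: "reduced_word n (w \<circ> swp b) bs" for a b as bs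
    proof -
      let ?v = "w \<circ> swp a \<circ> swp b"
      have a: "1 \<le> a" "a < n" and b: "1 \<le> b" "b < n" using ab dom by auto
      have pa: "w \<circ> swp a permutes {1..n}" and pb: "w \<circ> swp b permutes {1..n}"
        using comp_swp_permutes[OF w] a b by auto
      have v: "?v permutes {1..n}" using comp_swp_permutes[OF pa b] .
      have v': "?v = w \<circ> swp b \<circ> swp a" using ab by (auto simp: fun_eq_iff swp_def)
      have lv: "len (w \<circ> swp a) = len ?v + 1"
        using ab db by (intro len_descent[OF pa b]) (simp add: swp_def)
      have la: "len w = len (w \<circ> swp a) + 1" "len w = len (w \<circ> swp b) + 1"
        using len_descent[OF w a da] len_descent[OF w b db] by auto
      obtain xs where xs: "set xs \<subseteq> {1..n-1}" "word_perm xs = ?v" "length xs = len ?v"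
        using ex_word[OF v] by blast
      have "reduced_word n (w \<circ> swp a) (xs @ [b])"
        using xs lv b by (auto simp: reduced_word_iff[OF pa])
      then have 1: "foldr t as y = foldr t (xs @ [b]) y" for y
        using IH[OF ra _ pa] la by simp
      have "reduced_word n (w \<circ> swp b) (xs @ [a])"
        using xs lv a la by (auto simp: reduced_word_iff[OF pb] v')
      then have 2: "foldr t bs y = foldr t (xs @ [a]) y" for y
        using IH[OF rb _ pb] la by simp
      show ?thesis using 1 2 comm[OF ab] by simp
    qed
    \<comment> \<open>Here \<open>?v\<close> is w with the longest element of the rank-two subgroup
      split off. With a reduced word \<open>xs\<close> of \<open>?v\<close>, the two given words
      become \<open>xs @ [a, b, a]\<close> and \<open>xs @ [b, a, b]\<close>.\<close>
    have near: "foldr t (as @ [a]) x = foldr t (bs @ [b]) x"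
      if b: "b = a + 1" and dom: "1 \<le> a" "b < n" and da: "w (a + 1) < w a" and db: "w (b + 1) < w b"
        and ra: "reduced_word n (w \<circ> swp a) as" and rb: "reduced_word n (w \<circ> swp b) bs" for a b as bs
    proof -
      let ?v = "w \<circ> swp a \<circ> swp b \<circ> swp a"
      have a: "1 \<le> a" "a < n" and b': "1 \<le> b" "b < n" using b dom by auto
      have pa: "w \<circ> swp a permutes {1..n}" and pb: "w \<circ> swp b permutes {1..n}"
        using comp_swp_permutes[OF w] a b' by auto
      have pab: "w \<circ> swp a \<circ> swp b permutes {1..n}" using comp_swp_permutes[OF pa b'] .
      have v: "?v permutes {1..n}" using comp_swp_permutes[OF pab a] .
      have v': "?v = w \<circ> swp b \<circ> swp a \<circ> swp b" using b by (auto simp: fun_eq_iff swp_def)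
      have lv: "len (w \<circ> swp a) = len (w \<circ> swp a \<circ> swp b) + 1"
        using b da db by (intro len_descent[OF pa b']) (simp add: swp_def)
      have lv': "len (w \<circ> swp a \<circ> swp b) = len ?v + 1"
        using b da db by (intro len_descent[OF pab a]) (simp add: swp_def)
      have la: "len w = len (w \<circ> swp a) + 1" "len w = len (w \<circ> swp b) + 1"
        using len_descent[OF w a da] len_descent[OF w b' db] by auto
      obtain xs where xs: "set xs \<subseteq> {1..n-1}" "word_perm xs = ?v" "length xs = len ?v"
        using ex_word[OF v] by blast
      have "word_perm (xs @ [a, b]) = w \<circ> swp a"
        using xs word_perm_snoc[of "xs @ [a]" b] by simp
      then have "reduced_word n (w \<circ> swp a) (xs @ [a, b])"
        using xs lv lv' a b' by (auto simp: reduced_word_iff[OF pa])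
      then have 1: "foldr t as y = foldr t (xs @ [a, b]) y" for y
        using IH[OF ra _ pa] la by simp
      have "word_perm (xs @ [b, a]) = w \<circ> swp b"
        using xs word_perm_snoc[of "xs @ [b]" a] by (simp add: v')
      then have "reduced_word n (w \<circ> swp b) (xs @ [b, a])"
        using xs lv lv' a b' la by (auto simp: reduced_word_iff[OF pb])
      then have 2: "foldr t bs y = foldr t (xs @ [b, a]) y" for y
        using IH[OF rb _ pb] la by simp
      show ?thesis using 1 2 braid[of a] b by simp
    qed
    consider "j = k" | "j + 1 < k" | "k + 1 < j" | "k = j + 1" | "j = k + 1" by linarith
    then show ?thesis
    proof cases
      case 1
      then show ?thesis using IH[OF rj _ pj] rk lj snoc vs' by simp
    next
      case 2
      then show ?thesis using far[OF 2 _ _ dj dk rj rk] jk snoc vs' by simp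
    next
      case 3
      then show ?thesis using far[OF 3 _ _ dk dj rk rj] jk snoc vs' by simp
    next
      case 4
      then show ?thesis using near[OF 4 _ _ dj dk rj rk] jk snoc vs' by simp
    next
      case 5
      then show ?thesis using near[OF 5 _ _ dk dj rk rj] jk snoc vs' by simp
    qed
  qed
qed

section \<open>q-integers and the length generating function of the symmetric group\<close>

definition qint :: "'a::comm_ring_1 \<Rightarrow> nat \<Rightarrow> 'a" where
  "qint q n = (\<Sum>i<n. q ^ i)"

definition qfact :: "'a::comm_ring_1 \<Rightarrow> nat \<Rightarrow> 'a" where
  "qfact q n = (\<Prod>k=1..n. qint q k)"

lemma qint_add: "qint q (m + n) = qint q m + q ^ m * qint q n"
  by (induction n) (auto simp: qint_def algebra_simps power_add)

lemma qint_0 [simp]: "qint q 0 = 0" and qint_1 [simp]: "qint q (Suc 0) = 1"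
  by (auto simp: qint_def)

lemma qfact_0 [simp]: "qfact q 0 = 1"
  and qfact_Suc: "qfact q (Suc n) = qint q (Suc n) * qfact q n"
  by (auto simp: qfact_def mult.commute)

lemma word_perm_bij: "bij (word_perm ws)"
proof (induction ws)
  case (Cons j ws)
  then show ?case unfolding word_perm_Cons by (intro bij_comp) auto
qed (simp add: bij_id[unfolded id_def])

text \<open>The product s_n ... s_b, a cycle sending b to n + 1: composing v with it inserts the
  value n + 1 at position b of the one-line notation of v.\<close>

definition cyc :: "nat \<Rightarrow> nat \<Rightarrow> nat \<Rightarrow> nat" where
  "cyc n b = word_perm (rev [b..<Suc n])"

lemma cyc_last: "cyc n (Suc n) = id"
  by (simp add: cyc_def)

lemma cyc_step: "b \<le> n \<Longrightarrow> cyc n b = cyc n (b + 1) \<circ> swp b"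
  unfolding cyc_def by (subst upt_conv_Cons) (simp_all del: upt_Suc add: word_perm_snoc)

text \<open>The largest value moves left one position at a time, and each such move turns an ascent
  into a descent.\<close>

lemma insert_max_at:
  assumes v: "v permutes {1..n}"
  shows "1 \<le> b \<Longrightarrow> b \<le> Suc n \<Longrightarrow>
    v \<circ> cyc n b permutes {1..Suc n} \<and>
    (v \<circ> cyc n b) b = Suc n \<and>
    len (v \<circ> cyc n b) = len v + (Suc n - b)"
proof (induction "Suc n - b" arbitrary: b)
  case 0
  then have b: "b = Suc n" by simp
  have "v permutes {1..Suc n}" using v by (rule permutes_subset) auto
  moreover have "v (Suc n) = Suc n" using v by (rule permutes_not_in) auto
  ultimately show ?case by (simp add: b cyc_last)
next
  case (Suc m)
  let ?u = "v \<circ> cyc n (b + 1)"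
  have b: "1 \<le> b" "b < Suc n" using Suc by auto
  have "?u permutes {1..Suc n} \<and> ?u (b + 1) = Suc n \<and> len ?u = len v + (Suc n - (b + 1))"
    using Suc by (intro Suc.hyps(1)) auto
  then have u: "?u permutes {1..Suc n}" "?u (b + 1) = Suc n" "len ?u = len v + (Suc n - (b + 1))"
    by blast+
  have eq: "v \<circ> cyc n b = ?u \<circ> swp b"
    using b by (simp only: cyc_step o_assoc less_Suc_eq_le)
  have "?u b \<in> {1..Suc n}" using b permutes_in_image[OF u(1), of b] by auto
  moreover have "?u b \<noteq> ?u (b + 1)" by (rule permutes_neq[OF u(1)]) simp
  ultimately have asc: "?u b < ?u (b + 1)" using u(2) by auto
  have 1: "(?u \<circ> swp b) b = Suc n" using u(2) by (simp add: swp_def)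
  have 2: "len (?u \<circ> swp b) = len v + (Suc n - b)"
    unfolding len_ascent[OF u(1) asc] u(3) using b by simp
  show ?case
    unfolding eq using comp_swp_permutes[OF u(1) b] 1 2 by blast
qed

text \<open>Every permutation of n + 1 values arises exactly once by inserting the largest value,
  and the n + 1 positions contribute 1, q, ..., q^n.\<close>

lemma sum_power_len:
  fixes q :: "'a::comm_ring_1"
  shows "(\<Sum>w | w permutes {1..n}. q ^ len w) = qfact q n"
proof (induction n)
  case (Suc n)
  let ?S = "\<lambda>n. {w. w permutes {1..n::nat}}"
  let ?f = "\<lambda>(b, v). v \<circ> cyc n b"
  have fin: "finite (?S n)" for n by (rule finite_permutations) simp
  have c: "bij (cyc n b)" for b
    unfolding cyc_def by (rule word_perm_bij)
  have inj: "inj_on ?f ({1..Suc n} \<times> ?S n)"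
  proof (rule inj_onI, clarify)
    fix b v b' v'
    assume b: "b \<in> {1..Suc n}" "b' \<in> {1..Suc n}" and v: "v permutes {1..n}" "v' permutes {1..n}"
      and eq: "v \<circ> cyc n b = v' \<circ> cyc n b'"
    have 1: "(v \<circ> cyc n b) b = Suc n" "(v' \<circ> cyc n b') b' = Suc n" "v \<circ> cyc n b permutes {1..Suc n}"
      using insert_max_at[OF v(1), of b] insert_max_at[OF v(2), of b'] b by auto
    then have bb: "b = b'" using eq permutes_neq by metis
    have "v = v'"
      using eq c[of b] unfolding bb by (metis (no_types, lifting) bij_is_surj comp_assoc comp_id surj_iff)
    with bb show "b = b' \<and> v = v'" by simp
  qed
  have sub: "?f ` ({1..Suc n} \<times> ?S n) \<subseteq> ?S (Suc n)"
    using insert_max_at by auto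
  \<comment> \<open>Surjectivity comes from counting: the image of the injection already has (n +
    1)! elements.\<close>
  have "card (?f ` ({1..Suc n} \<times> ?S n)) = card (?S (Suc n))"
    using card_permutations[of "{1..n}" n] card_permutations[of "{1..Suc n}" "Suc n"]
    unfolding card_image[OF inj] by (simp add: card_cartesian_product)
  then have img: "?f ` ({1..Suc n} \<times> ?S n) = ?S (Suc n)"
    by (rule card_subset_eq[OF fin sub])
  have "(\<Sum>w\<in>?S (Suc n). q ^ len w) = (\<Sum>p\<in>{1..Suc n} \<times> ?S n. q ^ len (?f p))"
    unfolding img[symmetric] by (subst sum.reindex[OF inj]) (rule sum.cong[OF refl], simp only: o_apply)
  also have "\<dots> = (\<Sum>(b, v)\<in>{1..Suc n} \<times> ?S n. q ^ (Suc n - b) * q ^ len v)"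
  proof (intro sum.cong refl, clarify)
    fix b v assume "b \<in> {1..Suc n}" "v permutes {1..n}"
    then show "q ^ len (v \<circ> cyc n b) = q ^ (Suc n - b) * q ^ len v"
      using insert_max_at[of v n b] by (auto simp only: power_add mult.commute atLeastAtMost_iff)
  qed
  also have "\<dots> = (\<Sum>b=1..Suc n. q ^ (Suc n - b)) * (\<Sum>v\<in>?S n. q ^ len v)"
    unfolding sum_product sum.cartesian_product by (simp only:)
  also have "(\<Sum>b=1..Suc n. q ^ (Suc n - b)) = qint q (Suc n)"
    unfolding qint_def by (rule sum.reindex_bij_witness[of _ "\<lambda>i. Suc n - i" "\<lambda>b. Suc n - b"]) auto
  finally show ?case using Suc by (simp add: qfact_Suc)
next
  case 0
  have "{w. w permutes {1..0::nat}} = {id}" by (auto simp: permutes_id)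
  then show ?case by (simp add: len_id[unfolded id_def])
qed

section \<open>The trimming functional on exponent vectors\<close>

text \<open>\<open>tau x y\<close> is the operator \<open>f \<mapsto> (f(u, 0) - f(0, u)) / u\<close> on the monomial with exponents \<open>x, y\<close>,
  followed by a functional \<open>g\<close> of the resulting exponent.\<close>

definition tau :: "nat \<Rightarrow> nat \<Rightarrow> (nat \<Rightarrow> 'k::comm_ring_1) \<Rightarrow> 'k" where
  "tau x y g = (if y = 0 \<and> x > 0 then g (x - 1) else 0) - (if x = 0 \<and> y > 0 then g (y - 1) else 0)"

fun trim_sum :: "'k::comm_ring_1 \<Rightarrow> (nat list \<Rightarrow> 'k) \<Rightarrow> nat list \<Rightarrow> 'k" where
  "trim_sum q F [] = 0"
| "trim_sum q F [x] = 0"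
| "trim_sum q F (x # y # r) = tau x y (\<lambda>z. F (z # r)) + q * trim_sum q (\<lambda>zs. F (x # zs)) (y # r)"

text \<open>The index is the degree: \<open>psi q n\<close> acts on n + 1 exponents, so it is
  psi_(n+1) of the overview. The recursion starts from one variable, where it reads off the constant
  term.\<close>

primrec psi :: "'k::comm_ring_1 \<Rightarrow> nat \<Rightarrow> nat list \<Rightarrow> 'k" where
  "psi q 0 = (\<lambda>cs. if cs = [0] then 1 else 0)"
| "psi q (Suc n) = trim_sum q (psi q n)"

abbreviation Psi :: "'k::comm_ring_1 \<Rightarrow> nat list \<Rightarrow> 'k" where
  "Psi q cs \<equiv> psi q (length cs - 1) cs"

lemma tau_cong: "(\<And>z. g z = h z) \<Longrightarrow> tau x y g = tau x y h"
  by (simp add: tau_def)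

lemma tau_zero [simp]: "tau x y (\<lambda>_. 0) = 0"
  by (simp add: tau_def)

lemma tau_add: "tau x y (\<lambda>z. g z + h z) = tau x y g + tau x y h"
  by (simp add: tau_def)

lemma tau_cmult: "tau x y (\<lambda>z. c * g z) = c * tau x y g"
  by (simp add: tau_def algebra_simps)

lemma tau_diff: "tau x y (\<lambda>z. g z - h z) = tau x y g - tau x y h"
  by (simp add: tau_def)

lemma trim_sum_cong:
  "(\<And>zs. Suc (length zs) = length cs \<Longrightarrow> F zs = G zs) \<Longrightarrow> trim_sum q F cs = trim_sum q G cs"
  by (induction q F cs arbitrary: G rule: trim_sum.induct) (simp_all cong: tau_cong)

lemma trim_sum_zero [simp]: "trim_sum q (\<lambda>_. 0) cs = 0"
  by (induction q "\<lambda>_::nat list. 0::'a" cs rule: trim_sum.induct) auto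

lemma trim_sum_add: "trim_sum q (\<lambda>z. F z + G z) cs = trim_sum q F cs + trim_sum q G cs"
proof (induction q F cs arbitrary: G rule: trim_sum.induct)
  case (3 q F x y r)
  show ?case by (simp only: trim_sum.simps tau_add 3) (simp add: algebra_simps)
qed simp_all

lemma trim_sum_cmult: "trim_sum q (\<lambda>z. c * F z) cs = c * trim_sum q F cs"
  by (induction q F cs rule: trim_sum.induct) (auto simp: tau_cmult algebra_simps)

lemma trim_sum_diff: "trim_sum q (\<lambda>z. F z - G z) cs = trim_sum q F cs - trim_sum q G cs"
  using trim_sum_add[of q F "\<lambda>z. (-1) * G z" cs] trim_sum_cmult[of q "-1" G cs] by simp

lemma trim_sum_sum:
  "finite I \<Longrightarrow> trim_sum q (\<lambda>z. \<Sum>i\<in>I. F i z) cs = (\<Sum>i\<in>I. trim_sum q (F i) cs)"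
  by (induction rule: finite_induct) (auto simp: trim_sum_add)

text \<open>Sorts the trimmings by whether they act left of, on, or right of the adjacent pair x, y;
  the exponents beyond it are spectators.\<close>

lemma trim_sum_append:
  "trim_sum q F (us @ x # y # vs) = trim_sum q (\<lambda>z. F (z @ y # vs)) (us @ [x])
     + q ^ length us * tau x y (\<lambda>z. F (us @ z # vs))
     + q ^ Suc (length us) * trim_sum q (\<lambda>z. F (us @ x # z)) (y # vs)"
proof (induction us arbitrary: F)
  case (Cons u us)
  show ?case
  proof (cases us)
    case Nil
    then show ?thesis by (simp add: algebra_simps)
  next
    case (Cons u' us')
    then show ?thesis using Cons.IH[of "\<lambda>zs. F (u # zs)"] by (simp add: algebra_simps)
  qed
qed simp

lemma trim_sum_zeros: "trim_sum q F (replicate n 0) = 0"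
proof (induction n arbitrary: F)
  case (Suc n)
  show ?case
  proof (cases n)
    case (Suc m)
    then show ?thesis using Suc.IH[of "\<lambda>zs. F (0 # zs)"] by (simp add: tau_def)
  qed simp
qed simp

section \<open>Vanishing on multiples of quasisymmetric polynomials, expanded over finite boxes of
  exponents\<close>

definition box :: "nat \<Rightarrow> nat \<Rightarrow> nat list set" where
  "box n B = {c. length c = n \<and> set c \<subseteq> {..B}}"

lemma finite_box [simp]: "finite (box n B)"
  unfolding box_def using finite_lists_length_eq[of "{..B}" n] by (simp add: conj_commute)

lemma box_0 [simp]: "box 0 B = {[]}"
  by (auto simp: box_def)

lemma sum_box_Suc: "(\<Sum>c\<in>box (Suc n) B. F c) = (\<Sum>x\<le>B. \<Sum>c\<in>box n B. F (x # c))"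
proof -
  have "box (Suc n) B = (\<lambda>(x, c). x # c) ` ({..B} \<times> box n B)"
    by (force simp: box_def length_Suc_conv)
  moreover have "inj_on (\<lambda>(x, c). x # c) ({..B} \<times> box n B)"
    by (auto simp: inj_on_def)
  ultimately show ?thesis
    by (simp add: sum.reindex sum.cartesian_product split_def)
qed

abbreviation nonzero :: "nat list \<Rightarrow> nat list" where
  "nonzero \<equiv> filter (\<lambda>x. x \<noteq> 0)"

text \<open>Here \<open>h c d\<close> is the coefficient as a function of two adjacent exponents,
  and the hypotheses are quasisymmetry for that pair. A nonzero value of \<open>tau\<close> needs
  one total exponent to be 0; this forces c = 0 or d = 0, where \<open>h\<close> reduces to
  \<open>h'\<close>.\<close>

lemma tau_transport:
  fixes h :: "nat \<Rightarrow> nat \<Rightarrow> 'k::comm_ring_1"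
  assumes h: "\<And>c. h c 0 = h' c" "\<And>c. h 0 c = h' c"
  shows "(\<Sum>c\<le>B. \<Sum>d\<le>B. h c d * tau (x + c) (y + d) g) = tau x y (\<lambda>z. \<Sum>d\<le>B. h' d * g (z + d))"
proof -
  have 1: "(\<Sum>d\<le>B. h c d * (if y + d = 0 \<and> x + c > 0 then g (x + c - 1) else 0))
      = (if y = 0 \<and> x + c > 0 then h' c * g (x + c - 1) else 0)" for c
  proof -
    have "(\<Sum>d\<le>B. h c d * (if y + d = 0 \<and> x + c > 0 then g (x + c - 1) else 0))
      = (\<Sum>d\<le>B. if d = 0 then (if y = 0 \<and> x + c > 0 then h' c * g (x + c - 1) else 0) else 0)"
      by (intro sum.cong) (auto simp: h)
    then show ?thesis by simp
  qed
  have 2: "(\<Sum>c\<le>B. h c d * (if x + c = 0 \<and> y + d > 0 then g (y + d - 1) else 0))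
      = (if x = 0 \<and> y + d > 0 then h' d * g (y + d - 1) else 0)" for d
  proof -
    have "(\<Sum>c\<le>B. h c d * (if x + c = 0 \<and> y + d > 0 then g (y + d - 1) else 0))
      = (\<Sum>c\<le>B. if c = 0 then (if x = 0 \<and> y + d > 0 then h' d * g (y + d - 1) else 0) else 0)"
      by (intro sum.cong) (auto simp: h)
    then show ?thesis by simp
  qed
  have "(\<Sum>c\<le>B. \<Sum>d\<le>B. h c d * tau (x + c) (y + d) g)
     = (\<Sum>c\<le>B. \<Sum>d\<le>B. h c d * (if y + d = 0 \<and> x + c > 0 then g (x + c - 1) else 0))
     - (\<Sum>c\<le>B. \<Sum>d\<le>B. h c d * (if x + c = 0 \<and> y + d > 0 then g (y + d - 1) else 0))"
    unfolding tau_def right_diff_distrib sum_subtractf ..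
  also have "(\<Sum>c\<le>B. \<Sum>d\<le>B. h c d * (if x + c = 0 \<and> y + d > 0 then g (y + d - 1) else 0))
     = (\<Sum>d\<le>B. \<Sum>c\<le>B. h c d * (if x + c = 0 \<and> y + d > 0 then g (y + d - 1) else 0))"
    by (rule sum.swap)
  also have "(\<Sum>c\<le>B. \<Sum>d\<le>B. h c d * (if y + d = 0 \<and> x + c > 0 then g (x + c - 1) else 0)) - \<dots>
     = (\<Sum>c\<le>B. (if y = 0 \<and> x + c > 0 then h' c * g (x + c - 1) else 0)
          - (if x = 0 \<and> y + c > 0 then h' c * g (y + c - 1) else 0))"
    by (simp only: 1 2 sum_subtractf)
  also have "\<dots> = tau x y (\<lambda>z. \<Sum>d\<le>B. h' d * g (z + d))"
    by (cases "x = 0"; cases "y = 0") (auto simp: tau_def sum_negf[symmetric] intro!: sum.cong)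
  finally show ?thesis .
qed

text \<open>The Leibniz rule for trimming: quasisymmetric functions are annihilated by trimming, hence
  behave as scalars.\<close>

lemma trim_sum_quasisym:
  assumes "length a = Suc n" "n \<ge> 1"
  shows "(\<Sum>c\<in>box (Suc n) B. P (nonzero c) * trim_sum q F (map2 (+) a c))
    = trim_sum q (\<lambda>a'. \<Sum>d\<in>box n B. P (nonzero d) * F (map2 (+) a' d)) a"
  using assms
proof (induction n arbitrary: a F P)
  case (Suc n)
  then obtain x y r where a: "a = x # y # r" and r: "length r = n" by (auto simp: length_Suc_conv)
  have first: "(\<Sum>c0\<le>B. \<Sum>c1\<le>B. P (nonzero (c0 # c1 # c)) * tau (x + c0) (y + c1) (\<lambda>z. F (z # map2 (+) r c)))
     = tau x y (\<lambda>z. \<Sum>d\<le>B. P (nonzero (d # c)) * F ((z + d) # map2 (+) r c))" for c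
    by (rule tau_transport) auto
  have second: "(\<Sum>c\<in>box (Suc n) B. P (nonzero (c0 # c)) * trim_sum q (\<lambda>zs. F ((x + c0) # zs)) (map2 (+) (y # r) c))
     = trim_sum q (\<lambda>a'. \<Sum>d\<in>box n B. P (nonzero (c0 # d)) * F ((x + c0) # map2 (+) a' d)) (y # r)" for c0
  proof (cases "n = 0")
    case True
    then show ?thesis using r by (simp add: sum_box_Suc)
  next
    case False
    \<comment> \<open>The exponent c0 of the spectator variable is absorbed into the coefficient
      function; a zero exponent leaves no trace there.\<close>
    let ?P = "\<lambda>l. P (if c0 = 0 then l else c0 # l)"
    have P: "P (nonzero (c0 # c)) = ?P (nonzero c)" for c by simp
    show ?thesis unfolding P using Suc.IH[of "y # r" ?P "\<lambda>zs. F ((x + c0) # zs)"] False r by simp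
  qed
  have "(\<Sum>c\<in>box (Suc (Suc n)) B. P (nonzero c) * trim_sum q F (map2 (+) a c))
    = (\<Sum>c0\<le>B. \<Sum>c1\<le>B. \<Sum>c\<in>box n B. P (nonzero (c0 # c1 # c)) * tau (x + c0) (y + c1) (\<lambda>z. F (z # map2 (+) r c)))
    + q * (\<Sum>c0\<le>B. \<Sum>c\<in>box (Suc n) B. P (nonzero (c0 # c)) * trim_sum q (\<lambda>zs. F ((x + c0) # zs)) (map2 (+) (y # r) c))"
    by (simp add: sum_box_Suc a distrib_left sum.distrib sum_distrib_left mult.left_commute del: filter.simps)
  also have "(\<Sum>c0\<le>B. \<Sum>c1\<le>B. \<Sum>c\<in>box n B. P (nonzero (c0 # c1 # c)) * tau (x + c0) (y + c1) (\<lambda>z. F (z # map2 (+) r c)))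
    = (\<Sum>c\<in>box n B. \<Sum>c0\<le>B. \<Sum>c1\<le>B. P (nonzero (c0 # c1 # c)) * tau (x + c0) (y + c1) (\<lambda>z. F (z # map2 (+) r c)))"
    by (simp only: sum.swap[of _ "box n B"])
  also have "\<dots> = (\<Sum>c\<in>box n B. tau x y (\<lambda>z. \<Sum>d\<le>B. P (nonzero (d # c)) * F ((z + d) # map2 (+) r c)))"
    by (simp only: first)
  also have "\<dots> = tau x y (\<lambda>z. \<Sum>c\<in>box n B. \<Sum>d\<le>B. P (nonzero (d # c)) * F ((z + d) # map2 (+) r c))"
    by (simp add: tau_def sum_subtractf sum_negf del: filter.simps)
  also have "\<dots> = tau x y (\<lambda>z. \<Sum>d\<in>box (Suc n) B. P (nonzero d) * F (map2 (+) (z # r) d))"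
    by (simp add: sum_box_Suc sum.swap[of _ "box n B"] del: filter.simps)
  also have "(\<Sum>c0\<le>B. \<Sum>c\<in>box (Suc n) B. P (nonzero (c0 # c)) * trim_sum q (\<lambda>zs. F ((x + c0) # zs)) (map2 (+) (y # r) c))
    = trim_sum q (\<lambda>a'. \<Sum>d\<in>box (Suc n) B. P (nonzero d) * F (map2 (+) (x # a') d)) (y # r)"
    (is "?X = ?Y")
  proof -
    have "?X = (\<Sum>c0\<le>B. trim_sum q (\<lambda>a'. \<Sum>d\<in>box n B. P (nonzero (c0 # d)) * F ((x + c0) # map2 (+) a' d)) (y # r))"
      by (intro sum.cong refl second)
    also have "\<dots> = trim_sum q (\<lambda>a'. \<Sum>c0\<le>B. \<Sum>d\<in>box n B. P (nonzero (c0 # d)) * F ((x + c0) # map2 (+) a' d)) (y # r)"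
      by (rule trim_sum_sum[symmetric]) simp
    also have "\<dots> = ?Y"
      by (rule trim_sum_cong) (simp add: sum_box_Suc del: filter.simps)
    finally show ?thesis .
  qed
  finally show ?case by (simp add: a)
qed simp

text \<open>\<open>P\<close> gives the coefficients of a quasisymmetric polynomial and
  \<open>a\<close> is the monomial multiplying it. The factor passes through all trimmings down to
  one variable, where only its constant term \<open>P []\<close> could contribute.\<close>

lemma psi_quasisym:
  assumes "P [] = 0"
  shows "length a = Suc n \<Longrightarrow> (\<Sum>c\<in>box (Suc n) B. P (nonzero c) * psi q n (map2 (+) a c)) = 0"
proof (induction n arbitrary: a)
  case 0
  then obtain x where "a = [x]" by (auto simp: length_Suc_conv)
  then show ?case using assms by (auto simp: sum_box_Suc intro!: sum.neutral)
next
  case (Suc n)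
  have "(\<Sum>c\<in>box (Suc (Suc n)) B. P (nonzero c) * psi q (Suc n) (map2 (+) a c))
    = trim_sum q (\<lambda>a'. \<Sum>d\<in>box (Suc n) B. P (nonzero d) * psi q n (map2 (+) a' d)) a"
    using trim_sum_quasisym[OF Suc.prems] by simp
  also have "\<dots> = trim_sum q (\<lambda>_. 0) a"
    by (rule trim_sum_cong) (use Suc in auto)
  finally show ?case by simp
qed

lemma trim_sum_degree:
  "(\<And>zs. Suc (length zs) = length cs \<Longrightarrow> Suc (sum_list zs) = sum_list cs \<Longrightarrow> F zs = 0) \<Longrightarrow>
    trim_sum q F cs = 0"
proof (induction q F cs rule: trim_sum.induct)
  case (3 q F x y r)
  have "trim_sum q (\<lambda>zs. F (x # zs)) (y # r) = 0" by (rule "3.IH") (simp add: "3.prems")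
  moreover have "tau x y (\<lambda>z. F (z # r)) = 0" by (auto simp: tau_def intro!: "3.prems")
  ultimately show ?case by simp
qed auto

text \<open>Each trimming removes one variable and one degree, and the recursion ends with degree 0
  in one variable.\<close>

lemma psi_degree: "length cs = Suc n \<Longrightarrow> sum_list cs \<noteq> n \<Longrightarrow> psi q n cs = 0"
proof (induction n arbitrary: cs)
  case (Suc n)
  show ?case unfolding psi.simps
    by (rule trim_sum_degree) (use Suc in auto)
qed (auto simp: length_Suc_conv)

section \<open>The first relation for psi, with Gaussian binomials indexed by the two block
  sizes\<close>

definition qbin :: "'k::field \<Rightarrow> nat \<Rightarrow> nat \<Rightarrow> 'k" where
  "qbin q i m = qfact q (i + m) / (qfact q i * qfact q m)"

lemma qfact_nonzero:
  fixes q :: "'k::field"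
  assumes "\<And>k. qint q (Suc k) \<noteq> 0"
  shows "qfact q n \<noteq> 0"
  by (induction n) (auto simp: qfact_Suc assms)

text \<open>This is [i+m+2] = [i+1] + q^(i+1) [m+1] multiplied by [i+m+1]! and divided by the two
  block factorials.\<close>

lemma qbin_Pascal:
  fixes q :: "'k::field"
  assumes nz: "\<And>k. qint q (Suc k) \<noteq> 0"
  shows "qbin q (Suc i) (Suc m) = qbin q i (Suc m) + q ^ Suc i * qbin q (Suc i) m"
proof -
  note [simp] = qfact_nonzero[OF nz] nz
  have "qfact q (Suc i + Suc m) = (qint q (Suc i) + q ^ Suc i * qint q (Suc m)) * qfact q (Suc (i + m))"
    using qint_add[of q "Suc i" "Suc m"] by (simp add: qfact_Suc)
  moreover have "qbin q i (Suc m) = qint q (Suc i) * qfact q (Suc (i + m)) / (qfact q (Suc i) * qfact q (Suc m))"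
    by (simp add: qbin_def qfact_Suc[of q i])
  moreover have "qbin q (Suc i) m = qint q (Suc m) * qfact q (Suc (i + m)) / (qfact q (Suc i) * qfact q (Suc m))"
    by (simp add: qbin_def qfact_Suc[of q m])
  ultimately show ?thesis
    unfolding qbin_def[of q "Suc i" "Suc m"] by (simp only: distrib_right add_divide_distrib mult.assoc times_divide_eq_right)
qed

lemma qbin_0:
  fixes q :: "'k::field"
  assumes nz: "\<And>k. qint q (Suc k) \<noteq> 0"
  shows "qbin q 0 m = 1" "qbin q m 0 = 1"
  by (simp_all add: qbin_def qfact_nonzero[OF nz])

text \<open>With R f = (f(z,0) - f(0,z)) / z, this rule and the next are R(y f) = z R f - f(z,0) and
  R(x f) = z R f + f(0,z) on monomials.\<close>

lemma tau_Suc_right: "tau u (Suc x) h = tau u x (\<lambda>z. h (Suc z)) - (if x = 0 then h u else 0)"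
  by (cases u; cases x) (auto simp: tau_def)

lemma tau_Suc_left: "tau (Suc y) v k = tau y v (\<lambda>z. k (Suc z)) + (if y = 0 then k v else 0)"
  by (cases v; cases y) (auto simp: tau_def)

text \<open>The part of \<open>psi_relation\<close> from trimmings left of the pair x, y. Trimmings
  that do not touch x inherit the relation \<open>rel\<close> of one variable less; the one on u, x
  adds the correction of \<open>tau_Suc_right\<close>.\<close>

lemma trim_sum_relation_left:
  fixes q :: "'k::comm_ring_1"
  assumes rel: "\<And>z x. length z = length us \<Longrightarrow>
      q * F (z @ Suc x # y # vs) - F (z @ x # Suc y # vs) = c * E (z @ [x])"
  shows "q * trim_sum q (\<lambda>z. F (z @ y # vs)) (us @ [u, Suc x])
      - trim_sum q (\<lambda>z. F (z @ Suc y # vs)) (us @ [u, x])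
      + q ^ Suc (length us) * (if x = 0 then F (us @ u # y # vs) else 0)
    = c * trim_sum q E (us @ [u, x])"
proof -
  let ?h = "\<lambda>z. F (us @ z # y # vs)" and ?k = "\<lambda>z. F (us @ z # Suc y # vs)"
  have 1: "q * trim_sum q (\<lambda>z. F (z @ Suc x # y # vs)) (us @ [u]) - trim_sum q (\<lambda>z. F (z @ x # Suc y # vs)) (us @ [u])
      = c * trim_sum q (\<lambda>z. E (z @ [x])) (us @ [u])"
    unfolding trim_sum_cmult[symmetric] trim_sum_diff[symmetric]
    by (rule trim_sum_cong) (simp add: rel)
  have 2: "q * tau u x (\<lambda>z. ?h (Suc z)) - tau u x ?k = c * tau u x (\<lambda>z. E (us @ [z]))"
    unfolding tau_cmult[symmetric] tau_diff[symmetric] by (rule tau_cong) (simp add: rel)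
  have 3: "tau u (Suc x) ?h = tau u x (\<lambda>z. ?h (Suc z)) - (if x = 0 then ?h u else 0)"
    by (rule tau_Suc_right)
  have 4: "trim_sum q G (us @ [u, z]) = trim_sum q (\<lambda>w. G (w @ [z])) (us @ [u])
      + q ^ length us * tau u z (\<lambda>w. G (us @ [w]))" for G z
    by (simp add: trim_sum_append)
  have "q * trim_sum q (\<lambda>z. F (z @ y # vs)) (us @ [u, Suc x])
      - trim_sum q (\<lambda>z. F (z @ Suc y # vs)) (us @ [u, x])
    = (q * trim_sum q (\<lambda>z. F (z @ Suc x # y # vs)) (us @ [u]) - trim_sum q (\<lambda>z. F (z @ x # Suc y # vs)) (us @ [u]))
     + q ^ length us * ((q * tau u x (\<lambda>z. ?h (Suc z)) - tau u x ?k) - q * (if x = 0 then ?h u else 0))"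
    by (simp add: 4 3 algebra_simps)
  then show ?thesis unfolding 1 2 4[of E] by (simp add: algebra_simps)
qed

text \<open>Mirror image of the preceding lemma, for trimmings right of the pair; the correction now
  comes from \<open>tau_Suc_left\<close>.\<close>

lemma trim_sum_relation_right:
  fixes q :: "'k::comm_ring_1"
  assumes rel: "\<And>z y. length z = length vs \<Longrightarrow> q * F1 (y # z) - F2 (Suc y # z) = c * E (y # z)"
  shows "q * trim_sum q F1 (y # v # vs) - trim_sum q F2 (Suc y # v # vs) + (if y = 0 then F2 (v # vs) else 0)
    = c * trim_sum q E (y # v # vs)"
proof -
  have 1: "q * trim_sum q (\<lambda>z. F1 (y # z)) (v # vs) - trim_sum q (\<lambda>z. F2 (Suc y # z)) (v # vs)
      = c * trim_sum q (\<lambda>z. E (y # z)) (v # vs)"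
    unfolding trim_sum_cmult[symmetric] trim_sum_diff[symmetric]
    by (rule trim_sum_cong) (simp add: rel)
  have 2: "q * tau y v (\<lambda>z. F1 (z # vs)) - tau y v (\<lambda>z. F2 (Suc z # vs)) = c * tau y v (\<lambda>z. E (z # vs))"
    unfolding tau_cmult[symmetric] tau_diff[symmetric] by (rule tau_cong) (simp add: rel)
  have 3: "tau (Suc y) v (\<lambda>z. F2 (z # vs)) = tau y v (\<lambda>z. F2 (Suc z # vs)) + (if y = 0 then F2 (v # vs) else 0)"
    by (rule tau_Suc_left)
  have "q * trim_sum q F1 (y # v # vs) - trim_sum q F2 (Suc y # v # vs) + (if y = 0 then F2 (v # vs) else 0)
    = (q * tau y v (\<lambda>z. F1 (z # vs)) - tau y v (\<lambda>z. F2 (Suc z # vs)))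
     + q * (q * trim_sum q (\<lambda>z. F1 (y # z)) (v # vs) - trim_sum q (\<lambda>z. F2 (Suc y # z)) (v # vs))"
    by (simp add: 3 algebra_simps)
  then show ?thesis unfolding 1 2 by (simp add: algebra_simps)
qed

text \<open>Trimming inside the left block shortens that block, trimming inside the right block
  shortens the other, and the two resulting binomials add up by Pascal's rule.\<close>

lemma psi_relation:
  fixes q :: "'k::field"
  assumes nz: "\<And>k. qint q (Suc k) \<noteq> 0"
  shows "n = length us + length vs \<Longrightarrow>
    q * psi q (Suc n) (us @ Suc x # y # vs) - psi q (Suc n) (us @ x # Suc y # vs)
    = qbin q (Suc (length us)) (Suc (length vs)) * psi q (length us) (us @ [x]) * psi q (length vs) (y # vs)"
proof (induction n arbitrary: us x y vs rule: less_induct)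
  case (less n)
  let ?F = "psi q n" and ?i = "length us" and ?m = "length vs"
  let ?A = "psi q ?i (us @ [x])" and ?B = "psi q ?m (y # vs)"
  have left: "q * trim_sum q (\<lambda>z. ?F (z @ y # vs)) (us @ [Suc x]) - trim_sum q (\<lambda>z. ?F (z @ Suc y # vs)) (us @ [x])
      + q ^ ?i * (if x = 0 then ?F (us @ y # vs) else 0) = qbin q ?i (Suc ?m) * ?A * ?B"
  proof (cases us rule: rev_cases)
    case Nil
    \<comment> \<open>With an empty left part there is nothing to trim, and the correction alone is
      the whole product: \<open>psi q 0 [x]\<close> is 1 exactly when x = 0.\<close>
    then show ?thesis using less.prems by (simp add: qbin_0[OF nz])
  next
    case (snoc us' u)
    have n: "n = Suc (length us' + length vs)" using less.prems snoc by simp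
    have "q * ?F (z @ Suc x # y # vs) - ?F (z @ x # Suc y # vs)
       = (qbin q (Suc (length us')) (Suc ?m) * ?B) * psi q (length us') (z @ [x])" if "length z = length us'" for z x
    proof -
      have "q * psi q (Suc (length us' + length vs)) (z @ Suc x # y # vs)
          - psi q (Suc (length us' + length vs)) (z @ x # Suc y # vs)
        = qbin q (Suc (length z)) (Suc ?m) * psi q (length z) (z @ [x]) * ?B"
        by (rule less.IH) (simp_all only: n that lessI)
      then show ?thesis by (simp only: n that mult_ac)
    qed
    from trim_sum_relation_left[where us = us' and u = u and x = x, OF this]
    show ?thesis by (simp only: snoc length_append_singleton append_assoc append_Cons append_Nil psi.simps mult_ac)
  qed
  have right: "q * trim_sum q (\<lambda>z. ?F (us @ Suc x # z)) (y # vs) - trim_sum q (\<lambda>z. ?F (us @ x # z)) (Suc y # vs)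
      + (if y = 0 then ?F (us @ x # vs) else 0) = qbin q (Suc ?i) ?m * ?A * ?B"
  proof (cases vs)
    case Nil
    then show ?thesis using less.prems by (simp add: qbin_0[OF nz])
  next
    case (Cons v vs')
    have n: "n = Suc (length us + length vs')" using less.prems Cons by simp
    have "q * ?F (us @ Suc x # y # z) - ?F (us @ x # Suc y # z)
       = (qbin q (Suc ?i) (Suc (length vs')) * ?A) * psi q (length vs') (y # z)" if "length z = length vs'" for z y
    proof -
      have "q * psi q (Suc (length us + length vs')) (us @ Suc x # y # z)
          - psi q (Suc (length us + length vs')) (us @ x # Suc y # z)
        = qbin q (Suc ?i) (Suc (length z)) * ?A * psi q (length z) (y # z)"
        by (rule less.IH) (simp_all only: n that lessI)
      then show ?thesis by (simp only: n that mult_ac)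
    qed
    from trim_sum_relation_right[where vs = vs' and ?F1.0 = "\<lambda>z. ?F (us @ Suc x # z)" and ?F2.0 = "\<lambda>z. ?F (us @ x # z)"
        and v = v and y = y, OF this]
    show ?thesis by (simp only: Cons list.size(4) add_0_right add_Suc_right One_nat_def psi.simps mult_ac)
  qed
  have mid: "q * tau (Suc x) y g - tau x (Suc y) g = (if y = 0 then q * g x else 0) + (if x = 0 then g y else 0)" for g
    by (auto simp: tau_def)
  have "q * psi q (Suc n) (us @ Suc x # y # vs) - psi q (Suc n) (us @ x # Suc y # vs)
    = (q * trim_sum q (\<lambda>z. ?F (z @ y # vs)) (us @ [Suc x]) - trim_sum q (\<lambda>z. ?F (z @ Suc y # vs)) (us @ [x]))
    + q ^ ?i * (q * tau (Suc x) y (\<lambda>z. ?F (us @ z # vs)) - tau x (Suc y) (\<lambda>z. ?F (us @ z # vs)))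
    + q ^ Suc ?i * (q * trim_sum q (\<lambda>z. ?F (us @ Suc x # z)) (y # vs) - trim_sum q (\<lambda>z. ?F (us @ x # z)) (Suc y # vs))"
    unfolding psi.simps trim_sum_append by (simp add: algebra_simps)
  \<comment> \<open>The correction at x = 0 from the left and the one at y = 0 from the right cancel
    the two terms of the trimming on the pair itself.\<close>
  also have "\<dots> = (qbin q ?i (Suc ?m) * ?A * ?B - q ^ ?i * (if x = 0 then ?F (us @ y # vs) else 0))
    + q ^ ?i * ((if y = 0 then q * ?F (us @ x # vs) else 0) + (if x = 0 then ?F (us @ y # vs) else 0))
    + q ^ Suc ?i * (qbin q (Suc ?i) ?m * ?A * ?B - (if y = 0 then ?F (us @ x # vs) else 0))"
    by (simp only: mid left[symmetric] right[symmetric] add_diff_cancel)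
  also have "\<dots> = (qbin q ?i (Suc ?m) + q ^ Suc ?i * qbin q (Suc ?i) ?m) * ?A * ?B"
    by (simp add: algebra_simps)
  finally show ?case by (simp only: qbin_Pascal[OF nz])
qed

section \<open>ABB exponents as ballot lists (a suffix sums to at most the number of entries after
  its first) and the exponent of q in the evaluation\<close>

primrec ballot :: "nat list \<Rightarrow> bool" where
  "ballot [] = True"
| "ballot (c # cs) = (c + sum_list cs \<le> length cs \<and> ballot cs)"

primrec weight :: "nat \<Rightarrow> nat list \<Rightarrow> nat" where
  "weight k [] = 0"
| "weight k (c # cs) = k * c + weight (Suc k) cs"

lemma weight_append: "weight k (us @ vs) = weight k us + weight (k + length us) vs"
  by (induction us arbitrary: k) auto

lemma ballot_append: "ballot (us @ vs) \<Longrightarrow> ballot vs"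
  by (induction us) auto

lemma ballot_shift: "ballot (us @ x # Suc y # vs) \<Longrightarrow> ballot (us @ Suc x # y # vs)"
  by (induction us) auto

lemma weight_zeros [simp]: "weight k (replicate n 0) = 0"
  by (induction n arbitrary: k) auto

text \<open>Only the first trimming acts nontrivially; all others see two zero exponents.\<close>

lemma psi_first: "psi q n (n # replicate n 0) = 1"
proof (induction n)
  case (Suc n)
  have "trim_sum q (\<lambda>zs. psi q n (Suc n # zs)) (replicate (Suc n) 0) = 0"
    by (rule trim_sum_zeros)
  then show ?case using Suc by (simp add: tau_def)
qed simp

text \<open>Moving one unit of exponent to the left neighbour lowers the weight by 1, keeps the list
  ballot, and divides psi by q because the product in \<open>psi_relation\<close> vanishes.\<close>

lemma psi_ballot:
  fixes q :: "'k::field"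
  assumes nz: "\<And>k. qint q (Suc k) \<noteq> 0"
  shows "length cs = Suc n \<Longrightarrow> sum_list cs = n \<Longrightarrow> ballot cs \<Longrightarrow> psi q n cs = q ^ weight 0 cs"
proof (induction "weight 0 cs" arbitrary: cs rule: less_induct)
  case less
  obtain c ds where cs: "cs = c # ds" using less.prems by (cases cs) auto
  show ?case
  proof (cases "\<exists>d\<in>set ds. d \<noteq> 0")
    case False
    then have ds: "ds = replicate n 0"
      using less.prems cs by (intro replicate_eqI) auto
    then show ?thesis using less.prems cs by (simp add: psi_first sum_list_replicate)
  next
    case True
    then obtain as d vs where ds: "ds = as @ d # vs" "d \<noteq> 0" by (meson split_list)
    obtain us x where us: "c # as = us @ [x]" by (metis rev_exhaust list.distinct(1))
    obtain y where y: "d = Suc y" using ds by (cases d) auto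
    have "cs = (c # as) @ d # vs" using cs ds by simp
    then have split: "cs = us @ x # Suc y # vs" unfolding us y by simp
    let ?cs' = "us @ Suc x # y # vs"
    have n: "n = Suc (length us + length vs)" using less.prems split by simp
    have w: "weight 0 cs = Suc (weight 0 ?cs')" by (simp add: split weight_append)
    have "ballot (Suc y # vs)" using less.prems(3) ballot_append[of "us @ [x]" "Suc y # vs"] split by simp
    \<comment> \<open>The ballot condition bounds the suffix sum, \<open>Suc y\<close> included, by
      \<open>length vs\<close>, so the prefix carries degree at least
      \<open>length us + 1\<close>.\<close>
    then have "sum_list (us @ [x]) \<noteq> length us" using less.prems(2) split n by auto
    then have zero: "psi q (length us) (us @ [x]) = 0" by (intro psi_degree) auto
    have "psi q n ?cs' = q ^ weight 0 ?cs'"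
      using less.prems split w by (intro less.hyps) (auto simp: ballot_shift)
    moreover have "psi q n cs = q * psi q n ?cs'"
      using psi_relation[OF nz, of "length us + length vs" us vs x y] zero n split by simp
    ultimately show ?thesis using w by simp
  qed
qed

section \<open>The second relation for psi and the uniqueness argument\<close>

lemma sum_box_nonzero_Nil:
  fixes F :: "nat list \<Rightarrow> 'k::comm_ring_1"
  shows "(\<Sum>c\<in>box (length a) B. (if nonzero c = [] then 1 else 0) * F (map2 (+) a c)) = F a"
proof (induction a arbitrary: F)
  case (Cons x a)
  have "(\<Sum>c\<in>box (length a) B. (if nonzero (c0 # c) = [] then 1 else 0) * F ((x + c0) # map2 (+) a c))
    = (if c0 = 0 then F (x # a) else 0)" for c0
    using Cons.IH[of "\<lambda>z. F (x # z)"] by (cases "c0 = 0") simp_all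
  then have "(\<Sum>c0\<le>B. \<Sum>c\<in>box (length a) B. (if nonzero (c0 # c) = [] then 1 else 0) * F ((x + c0) # map2 (+) a c))
    = F (x # a)" by simp
  then show ?case by (simp add: sum_box_Suc)
qed simp

text \<open>Presents x_1 + ... + x_n as the quasisymmetric polynomial whose coefficient function is
  the indicator of \<open>[1]\<close>; exponents up to 1 suffice.\<close>

lemma sum_box_nonzero_single:
  fixes F :: "nat list \<Rightarrow> 'k::comm_ring_1"
  shows "(\<Sum>c\<in>box (length a) 1. (if nonzero c = [1] then 1 else 0) * F (map2 (+) a c))
    = (\<Sum>i<length a. F (a[i := Suc (a ! i)]))"
proof (induction a arbitrary: F)
  case (Cons x a)
  have "(\<Sum>c\<in>box (length (x # a)) 1. (if nonzero c = [1] then 1 else 0) * F (map2 (+) (x # a) c))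
    = (\<Sum>c\<in>box (length a) 1. (if nonzero c = [1] then 1 else 0) * F (x # map2 (+) a c))
    + (\<Sum>c\<in>box (length a) 1. (if nonzero c = [] then 1 else 0) * F (Suc x # map2 (+) a c))"
    by (simp add: sum_box_Suc atMost_Suc)
  also have "\<dots> = (\<Sum>i<length a. F (x # a[i := Suc (a ! i)])) + F (Suc x # a)"
    using Cons.IH[of "\<lambda>z. F (x # z)"] sum_box_nonzero_Nil[where a = a and B = 1 and F = "\<lambda>z. F (Suc x # z)"] by simp
  also have "\<dots> = (\<Sum>i<length (x # a). F ((x # a)[i := Suc ((x # a) ! i)]))"
    unfolding length_Cons sum.lessThan_Suc_shift by simp
  finally show ?case .
qed simp

lemma psi_e1:
  assumes "length a = Suc n"
  shows "(\<Sum>i<Suc n. psi q n (a[i := Suc (a ! i)])) = 0"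
  using psi_quasisym[where P = "\<lambda>l. if l = [1] then 1 else 0" and a = a and n = n and B = 1 and q = q]
    sum_box_nonzero_single[where a = a and F = "psi q n"] assms
  by simp

text \<open>Applied to the difference of two functionals obeying both relations: the total is [n]_Q
  times the first term.\<close>

lemma geometric_zero:
  fixes d :: "nat \<Rightarrow> 'f::field"
  assumes step: "\<And>i. Suc i < n \<Longrightarrow> d (Suc i) = Q * d i"
    and total: "(\<Sum>i<n. d i) = 0" and nz: "qint Q n \<noteq> 0" and "i < n"
  shows "d i = 0"
proof -
  have d: "i < n \<Longrightarrow> d i = Q ^ i * d 0" for i by (induction i) (auto simp: step)
  have "(\<Sum>i<n. d i) = qint Q n * d 0"
    unfolding qint_def sum_distrib_right by (rule sum.cong) (use d in blast)+
  with total nz have "d 0 = 0" by simp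
  with d[OF \<open>i < n\<close>] show ?thesis by simp
qed

section \<open>The symmetrizer of the Demazure--Lusztig operators\<close>

text \<open>Abstracts the rational functions to a field with constants \<open>C\<close>, infinitely
  many variables \<open>X\<close> and simple transpositions \<open>s\<close>. \<open>X_indep\<close>
  is what keeps X_i - X_j and q X_i - X_j nonzero.\<close>

locale hecke_action =
  fixes C :: "'k::field_char_0 \<Rightarrow> 'f::field" and X :: "nat \<Rightarrow> 'f" and s :: "nat \<Rightarrow> 'f \<Rightarrow> 'f" and q :: 'k
  assumes C_add: "C (c + d) = C c + C d" and C_mult: "C (c * d) = C c * C d" and C_1 [simp]: "C 1 = 1"
    and s_add: "s j (x + y) = s j x + s j y" and s_mult: "s j (x * y) = s j x * s j y"
    and s_C [simp]: "s j (C c) = C c" and s_X [simp]: "s j (X i) = X (swp j i)"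
    and s_invol [simp]: "s j (s j x) = x"
    and s_comm: "i + 1 < j \<Longrightarrow> s i (s j x) = s j (s i x)"
    and s_braid: "s i (s (i + 1) (s i x)) = s (i + 1) (s i (s (i + 1) x))"
    and X_indep: "X i = C c * X j \<Longrightarrow> i = j"
    and qint_nonzero: "qint q (Suc k) \<noteq> 0"
begin

lemma C_0 [simp]: "C 0 = 0"
  using C_add[of 0 0] by (metis add.right_neutral add_left_cancel)

lemma C_diff: "C (c - d) = C c - C d"
  using C_add[of "c - d" d] by simp

lemma C_eq_0_iff [simp]: "C c = 0 \<longleftrightarrow> c = 0"
proof
  assume "C c = 0"
  show "c = 0"
  proof (rule ccontr)
    assume "c \<noteq> 0"
    then have "C c * C (1 / c) = 1" by (simp flip: C_mult)
    with \<open>C c = 0\<close> show False by simp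
  qed
qed simp

lemma C_power: "C (c ^ n) = C c ^ n"
  by (induction n) (auto simp: C_mult)

lemma C_sum: "C (sum f A) = (\<Sum>i\<in>A. C (f i))"
  by (induction A rule: infinite_finite_induct) (auto simp: C_add)

lemma s_0 [simp]: "s j 0 = 0" and s_1 [simp]: "s j 1 = 1"
  using s_C[of j 0] s_C[of j 1] by simp_all

lemma s_diff: "s j (x - y) = s j x - s j y"
  using s_add[of j "x - y" y] by simp

lemma s_eq_0_iff [simp]: "s j x = 0 \<longleftrightarrow> x = 0"
  by (metis s_0 s_invol)

lemma s_divide: "s j (x / y) = s j x / s j y"
proof (cases "y = 0")
  case False
  then have "s j (x / y) * s j y = s j x" by (simp flip: s_mult)
  with False show ?thesis by (simp add: eq_divide_eq)
qed simp

lemma s_power: "s j (x ^ n) = s j x ^ n"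
  by (induction n) (auto simp: s_mult)

lemma s_sum: "s j (sum f A) = (\<Sum>i\<in>A. s j (f i))"
  by (induction A rule: infinite_finite_induct) (auto simp: s_add)

lemma s_prod: "s j (prod f A) = (\<Prod>i\<in>A. s j (f i))"
  by (induction A rule: infinite_finite_induct) (auto simp: s_mult)

lemma X_inject [simp]: "X i = X j \<longleftrightarrow> i = j"
  using X_indep[of i 1 j] by auto

lemma qX_minus_X_nonzero: "i \<noteq> j \<Longrightarrow> C q * X i - X j \<noteq> 0"
  using X_indep[of j q i] by auto

section \<open>Hecke relations for the Demazure-Lusztig operators\<close>

definition T :: "nat \<Rightarrow> 'f \<Rightarrow> 'f" where
  "T j G = C (q - 1) * ((X j * G - s j (X j * G)) / (X j - X (j + 1))) + s j G"

text \<open>Coefficients of T_j = al + be s_j. They are defined for arbitrary index pairs because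
  the transpositions permute the indices.\<close>

definition al :: "nat \<Rightarrow> nat \<Rightarrow> 'f" where "al i j = (C q - 1) * X i / (X i - X j)"
definition be :: "nat \<Rightarrow> nat \<Rightarrow> 'f" where "be i j = (X i - C q * X j) / (X i - X j)"

lemma T_eq: "T j G = al j (Suc j) * G + be j (Suc j) * s j G"
proof -
  define d where "d = X j - X (Suc j)"
  have d: "d \<noteq> 0" by (simp add: d_def)
  have "T j G = ((C q - 1) * (X j * G - X (Suc j) * s j G) + d * s j G) / d"
    using d by (simp add: T_def s_mult swp_def C_diff add_divide_distrib d_def)
  also have "\<dots> = ((C q - 1) * X j * G + (X j - C q * X (Suc j)) * s j G) / d"
    by (simp add: d_def algebra_simps)
  finally show ?thesis by (simp add: al_def be_def d_def add_divide_distrib)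
qed

lemma s_al: "s j (al i k) = al (swp j i) (swp j k)"
  by (simp add: al_def s_divide s_mult s_diff)

lemma s_be: "s j (be i k) = be (swp j i) (swp j k)"
  by (simp add: be_def s_divide s_mult s_diff)

lemma be_eq:
  assumes "i \<noteq> j"
  shows "be i j = C q - al i j"
proof -
  have "C q - al i j = (C q * (X i - X j) - (C q - 1) * X i) / (X i - X j)"
    using assms by (simp add: al_def diff_divide_distrib)
  also have "C q * (X i - X j) - (C q - 1) * X i = X i - C q * X j"
    by (simp add: algebra_simps)
  finally show ?thesis by (simp add: be_def)
qed

lemma al_swap:
  assumes "i \<noteq> j"
  shows "al j i = C q - 1 - al i j"
proof -
  have "al j i = - ((C q - 1) * X j) / (X i - X j)"
    unfolding al_def minus_diff_eq[of "X i" "X j", symmetric] by (simp only: divide_minus_right minus_divide_left)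
  also have "\<dots> = ((C q - 1) * (X i - X j) - (C q - 1) * X i) / (X i - X j)"
    by (simp add: algebra_simps)
  finally show ?thesis
    using assms by (simp add: al_def diff_divide_distrib)
qed

text \<open>The partial fraction identity behind the braid relation: it trades a product of two
  neighbouring coefficients for \<open>al i k\<close> times a linear expression.\<close>

lemma al_product:
  assumes "i \<noteq> j" "j \<noteq> k" "i \<noteq> k"
  shows "al i j * al j k = al i k * (al i j + al j k - C q + 1)"
proof -
  define a b c r where "a = X i" "b = X j" "c = X k" "r = C q - 1"
  have ne: "a - b \<noteq> 0" "b - c \<noteq> 0" "a - c \<noteq> 0"
    using assms by (simp_all add: a_b_c_r_def)
  have "(r * a) * (r * b) * (a - c) = (r * a) * ((r * a) * (b - c) + (r * b) * (a - b) - r * ((a - b) * (b - c)))"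
    by (simp add: algebra_simps)
  then have "r * a / (a - b) * (r * b / (b - c)) = r * a / (a - c) * (r * a / (a - b) + r * b / (b - c) - r)"
    using ne by (simp add: divide_simps)
  then show ?thesis by (simp add: al_def a_b_c_r_def algebra_simps)
qed

text \<open>The comparisons of the coefficients of s_i, s_(i+1) and 1 in the two sides of the braid
  relation; the remaining coefficients agree as they stand.\<close>

lemma al_relation:
  assumes "i \<noteq> j" "j \<noteq> k" "i \<noteq> k"
  shows "al i j * al j k + al i k * al j i = al j k * al i k"
    and "al j k * al i j + al i k * al k j = al i j * al i k"
    and "al i j * al i j * al j k + be i j * al i k * be j i = al j k * al j k * al i j + be j k * al i k * be k j"
proof -
  let ?p = "al i j" and ?r = "al j k" and ?w = "al i k"
  note P = al_product[OF assms]
  have eqs: "al j i = C q - 1 - ?p" "al k j = C q - 1 - ?r" "be i j = C q - ?p" "be j i = 1 + ?p"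
    "be j k = C q - ?r" "be k j = 1 + ?r"
    using assms by (simp_all add: be_eq al_swap[of i j] al_swap[of j k])
  show "?p * ?r + ?w * al j i = ?r * ?w" and "?r * ?p + ?w * al k j = ?p * ?w"
    unfolding eqs mult.commute[of ?r ?p] P by (simp_all add: algebra_simps)
  have "?p * ?p * ?r - ?r * ?r * ?p = (?p * ?r) * (?p - ?r)" by (simp add: algebra_simps)
  also have "\<dots> = be j k * ?w * be k j - be i j * ?w * be j i"
    unfolding eqs P by (simp add: algebra_simps)
  finally show "?p * ?p * ?r + be i j * ?w * be j i = ?r * ?r * ?p + be j k * ?w * be k j"
    by (simp add: algebra_simps)
qed

lemma T_braid: "T i (T (i + 1) (T i G)) = T (i + 1) (T i (T (i + 1) G))"
proof -
  define a b c where "a = i" "b = i + 1" "c = i + 2"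
  have sw: "swp i a = b" "swp i b = a" "swp i c = c" "swp (i + 1) a = a" "swp (i + 1) b = c" "swp (i + 1) c = b"
    by (auto simp: swp_def a_b_c_def)
  have T1: "T i G = al a b * G + be a b * s i G" and T2: "T (i + 1) G = al b c * G + be b c * s (i + 1) G" for G
    by (simp_all add: T_eq a_b_c_def)
  have abc: "a \<noteq> b" "b \<noteq> c" "a \<noteq> c" by (auto simp: a_b_c_def)
  let ?s1 = "s i" and ?s2 = "s (i + 1)"
  note ss = s_add s_mult s_al s_be sw s_invol
  have "T i (T (i + 1) (T i G)) =
      (al a b * al a b * al b c + be a b * al a c * be b a) * G
    + be a b * (al a b * al b c + al a c * al b a) * ?s1 G
    + al a b * be b c * al a c * ?s2 G
    + al a b * be b c * be a c * ?s2 (?s1 G)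
    + be a b * be a c * al b c * ?s1 (?s2 G)
    + be a b * be a c * be b c * ?s1 (?s2 (?s1 G))"
    unfolding T1 T2 ss by (simp add: algebra_simps)
  moreover have "T (i + 1) (T i (T (i + 1) G)) =
      (al b c * al b c * al a b + be b c * al a c * be c b) * G
    + be b c * (al b c * al a b + al a c * al c b) * ?s2 G
    + al b c * be a b * al a c * ?s1 G
    + al a b * be b c * be a c * ?s2 (?s1 G)
    + be a b * be a c * al b c * ?s1 (?s2 G)
    + be a b * be a c * be b c * ?s2 (?s1 (?s2 G))"
    unfolding T1 T2 ss by (simp add: algebra_simps)
  ultimately show ?thesis
    unfolding al_relation[OF abc] s_braid by (simp add: algebra_simps)
qed

lemma T_comm: "i + 1 < j \<Longrightarrow> T i (T j G) = T j (T i G)"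
  unfolding T_eq s_add s_mult s_al s_be
  by (simp add: swp_def s_comm[of i j] algebra_simps)

lemma T_add: "T j (x + y) = T j x + T j y"
  by (simp add: T_eq s_add algebra_simps)

lemma T_scale: "s j y = y \<Longrightarrow> T j (y * x) = y * T j x"
  by (simp add: T_eq s_mult algebra_simps)

lemma T_1: "T j 1 = C q"
proof -
  show ?thesis by (simp add: T_eq be_eq)
qed

lemma T_quadratic: "T j (T j x) = (C q - 1) * T j x + C q * x"
proof -
  let ?a = "al j (Suc j)" and ?b = "be j (Suc j)" and ?a' = "al (Suc j) j" and ?b' = "be (Suc j) j"
  have eqs: "?b = C q - ?a" "?a' = C q - 1 - ?a" "?b' = 1 + ?a"
    by (simp_all add: be_eq al_swap[of j "Suc j"])
  have 1: "?a + ?a' = C q - 1" and 2: "?a * ?a + ?b * ?b' = (C q - 1) * ?a + C q"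
    unfolding eqs by (simp_all add: algebra_simps)
  have "T j (T j x) = (?a * ?a + ?b * ?b') * x + ?b * (?a + ?a') * s j x"
    by (simp add: T_eq s_add s_mult s_al s_be swp_def algebra_simps)
  then show ?thesis unfolding 1 2 by (simp add: T_eq algebra_simps)
qed

section \<open>The symmetrizer on the variables after position a, and its absorption of smaller
  symmetrizers\<close>

abbreviation Tw :: "nat \<Rightarrow> nat list \<Rightarrow> 'f \<Rightarrow> 'f" where
  "Tw a ws \<equiv> foldr (\<lambda>j. T (a + j)) ws"

definition Sy :: "nat \<Rightarrow> nat \<Rightarrow> 'f \<Rightarrow> 'f" where
  "Sy a n x = (\<Sum>w | w permutes {1..n}. Tw a (SOME ws. reduced_word n w ws) x)"

lemma Tw_add: "Tw a ws (x + y) = Tw a ws x + Tw a ws y"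
  by (induction ws) (auto simp: T_add)

lemma Tw_scale: "(\<And>j. j \<in> set ws \<Longrightarrow> s (a + j) y = y) \<Longrightarrow> Tw a ws (y * x) = y * Tw a ws x"
  by (induction ws) (auto simp: T_scale)

lemma Tw_1: "Tw a ws 1 = C (q ^ length ws)"
proof (induction ws)
  case (Cons j ws)
  have "T (a + j) (C (q ^ length ws) * 1) = C (q ^ length ws) * C q"
    by (subst T_scale) (simp_all add: T_1)
  then show ?case using Cons by (simp add: C_mult mult.commute)
qed simp

lemma Tw_reduced:
  assumes "reduced_word n w us" "reduced_word n w vs" "w permutes {1..n}"
  shows "Tw a us x = Tw a vs x"
proof (rule matsumoto[OF _ _ assms])
  show "T (a + i) (T (a + j) x) = T (a + j) (T (a + i) x)" if "i + 1 < j" for i j x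
    using that by (intro T_comm) simp
  show "T (a + i) (T (a + (i + 1)) (T (a + i) x)) = T (a + (i + 1)) (T (a + i) (T (a + (i + 1)) x))" for i x
    using T_braid[of "a + i" x] by (simp add: add.assoc)
qed

lemma some_reduced_word:
  assumes "w permutes {1..n}"
  shows "reduced_word n w (SOME ws. reduced_word n w ws)"
  using someI_ex[OF ex_reduced_word[OF assms]] .

lemma some_reduced_word_props:
  assumes "w permutes {1..n}"
  shows "set (SOME ws. reduced_word n w ws) \<subseteq> {1..n-1}" "length (SOME ws. reduced_word n w ws) = len w"
  using some_reduced_word[OF assms] unfolding reduced_word_iff[OF assms] by blast+

lemma Sy_add: "Sy a n (x + y) = Sy a n x + Sy a n y"
  by (simp add: Sy_def Tw_add sum.distrib)

lemma Sy_scale: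
  assumes "\<And>j. 1 \<le> j \<Longrightarrow> j < n \<Longrightarrow> s (a + j) y = y"
  shows "Sy a n (y * x) = y * Sy a n x"
  unfolding Sy_def sum_distrib_left
proof (intro sum.cong refl Tw_scale assms)
  fix w j assume "w \<in> {w. w permutes {1..n}}" "j \<in> set (SOME ws. reduced_word n w ws)"
  then have "j \<in> {1..n-1}" using some_reduced_word_props(1)[of w n] by blast
  then show "1 \<le> j" "j < n" by auto
qed

lemma Sy_C: "Sy a n (C c * x) = C c * Sy a n x"
  by (rule Sy_scale) simp

lemma Sy_0 [simp]: "Sy a n 0 = 0"
  using Sy_C[of a n 0 0] by simp

lemma Sy_diff: "Sy a n (x - y) = Sy a n x - Sy a n y"
  using Sy_add[of a n "x - y" y] by simp

lemma Sy_sum: "Sy a n (sum f A) = (\<Sum>i\<in>A. Sy a n (f i))"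
  by (induction A rule: infinite_finite_induct) (auto simp: Sy_add)

lemma Sy_1: "Sy a n 1 = C (qfact q n)"
  unfolding sum_power_len[symmetric] C_sum Sy_def Tw_1
  by (rule sum.cong) (auto simp: some_reduced_word_props)

text \<open>Pairing w with w s_j writes the symmetrizer as a sum of T_w (1 + T_j) over w with an
  ascent at j, and (1 + T_j) T_j = q (1 + T_j) by the quadratic relation.\<close>

lemma Sy_T:
  assumes j: "1 \<le> j" "j < n"
  shows "Sy a n (T (a + j) x) = C q * Sy a n x"
proof -
  define R where "R w = (SOME ws. reduced_word n w ws)" for w
  let ?S = "{w. w permutes {1..n}}"
  let ?A = "{w. w permutes {1..n} \<and> w j < w (j + 1)}"
  let ?B = "{w. w permutes {1..n} \<and> w (j + 1) < w j}"
  let ?f = "\<lambda>w. w \<circ> swp j"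
  have fin: "finite ?S" by (rule finite_permutations) simp
  have S: "?S = ?A \<union> ?B"
  proof (intro equalityI subsetI)
    fix w assume w: "w \<in> ?S"
    then have "w j \<noteq> w (j + 1)" by (intro permutes_neq[of w "{1..n}"]) auto
    with w show "w \<in> ?A \<union> ?B" by auto
  qed auto
  have B: "?B = ?f ` ?A"
  proof (intro equalityI subsetI)
    fix w assume w: "w \<in> ?B"
    then have "w \<circ> swp j \<in> ?A" using comp_swp_permutes[OF _ j, of w] by (auto simp: swp_def)
    moreover have "w = ?f (w \<circ> swp j)" by simp
    ultimately show "w \<in> ?f ` ?A" by blast
  next
    fix w assume "w \<in> ?f ` ?A"
    then obtain v where "v \<in> ?A" "w = v \<circ> swp j" by blast
    then show "w \<in> ?B" using comp_swp_permutes[OF _ j, of v] by (auto simp: swp_def)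
  qed
  have inj: "inj_on ?f ?A" by (rule inj_on_inverseI[of _ ?f]) simp
  have step: "Tw a (R (?f w)) y = Tw a (R w) (T (a + j) y)" if w: "w \<in> ?A" for w y
  proof -
    have wp: "w permutes {1..n}" and asc: "w j < w (j + 1)" using w by auto
    note fp = comp_swp_permutes[OF wp j]
    have Rw: "set (R w) \<subseteq> {1..n-1} \<and> word_perm (R w) = w \<and> length (R w) = len w"
      by (rule iffD1[OF reduced_word_iff[OF wp] some_reduced_word[OF wp, folded R_def]])
    have "len (?f w) = len w + 1" by (rule len_ascent[OF wp asc])
    moreover have "word_perm (R w @ [j]) = ?f w" using Rw by (simp only: word_perm_snoc)
    ultimately have "reduced_word n (?f w) (R w @ [j])"
      unfolding reduced_word_iff[OF fp] using Rw j by auto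
    then have "Tw a (R (?f w)) y = Tw a (R w @ [j]) y"
      unfolding R_def by (intro Tw_reduced[OF some_reduced_word[OF fp] _ fp])
    then show ?thesis by simp
  qed
  have Sy: "Sy a n y = (\<Sum>w\<in>?A. Tw a (R w) y + Tw a (R w) (T (a + j) y))" for y
  proof -
    have "Sy a n y = (\<Sum>w\<in>?A. Tw a (R w) y) + (\<Sum>w\<in>?B. Tw a (R w) y)"
      unfolding Sy_def R_def[symmetric] S
    proof (rule sum.union_disjoint)
      show "finite ?A" "finite ?B" by (rule finite_subset[OF _ fin], blast)+
    qed auto
    also have "(\<Sum>w\<in>?B. Tw a (R w) y) = (\<Sum>w\<in>?A. Tw a (R (?f w)) y)"
      unfolding B by (subst sum.reindex[OF inj]) (rule sum.cong[OF refl], simp only: o_apply)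
    also have "\<dots> = (\<Sum>w\<in>?A. Tw a (R w) (T (a + j) y))"
      by (intro sum.cong refl step)
    finally show ?thesis by (simp add: sum.distrib)
  qed
  have quad: "Tw a ws (T (a + j) (T (a + j) x)) = (C q - 1) * Tw a ws (T (a + j) x) + C q * Tw a ws x" for ws
    unfolding T_quadratic Tw_add using Tw_scale[of ws a "C (q - 1)"] Tw_scale[of ws a "C q"]
    by (simp add: C_diff s_diff)
  show ?thesis
    unfolding Sy quad sum_distrib_left by (intro sum.cong refl) (simp add: algebra_simps)
qed

lemma Sy_Tw:
  assumes "set ws \<subseteq> {1..m-1}" "a \<le> b" "b + m \<le> a + n"
  shows "Sy a n (Tw b ws x) = C (q ^ length ws) * Sy a n x"
  using assms(1)
proof (induction ws)
  case (Cons j ws)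
  have "Sy a n (T (a + (b - a + j)) (Tw b ws x)) = C q * Sy a n (Tw b ws x)"
    by (rule Sy_T) (use Cons.prems assms(2,3) in auto)
  then show ?case using Cons assms(2) by (simp add: C_mult)
qed simp

text \<open>Each inner T_w is absorbed as q^(length of w), and these powers sum to [m]!.\<close>

lemma Sy_Sy:
  assumes "a \<le> b" "b + m \<le> a + n"
  shows "Sy a n (Sy b m x) = C (qfact q m) * Sy a n x"
proof -
  have "Sy a n (Sy b m x) = (\<Sum>w | w permutes {1..m}. C (q ^ len w) * Sy a n x)"
    unfolding Sy_def[of b] Sy_sum
  proof (intro sum.cong refl)
    fix w assume "w \<in> {w. w permutes {1..m}}"
    then have w: "w permutes {1..m}" by simp
    show "Sy a n (Tw b (SOME ws. reduced_word m w ws) x) = C (q ^ len w) * Sy a n x"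
      unfolding some_reduced_word_props(2)[OF w, symmetric]
      by (rule Sy_Tw[OF some_reduced_word_props(1)[OF w] assms])
  qed
  then show ?thesis by (simp add: sum_power_len[symmetric] C_sum sum_distrib_right)
qed

section \<open>Brackets of monomials and their factorization over two blocks\<close>

primrec mon :: "nat \<Rightarrow> nat list \<Rightarrow> 'f" where
  "mon a [] = 1"
| "mon a (c # cs) = X (Suc a) ^ c * mon (Suc a) cs"

definition Dn :: "nat \<Rightarrow> nat \<Rightarrow> 'f" where
  "Dn a n = (\<Prod>j\<in>{1..<n}. C q * X (a + j) - X (Suc (a + j)))"

text \<open>The bracket of the monomial with exponents \<open>c\<close> in the variables \<open>x\<^bsub>a+1\<^esub>, x\<^bsub>a+2\<^esub>, \<dots>\<close>; the offset
  \<open>a\<close> makes room for parabolic subgroups.\<close>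

definition F :: "nat \<Rightarrow> nat list \<Rightarrow> 'f" where
  "F a c = Sy a (length c) (mon a c / Dn a (length c))"

lemma mon_append: "mon a (us @ vs) = mon a us * mon (a + length us) vs"
  by (induction us arbitrary: a) auto

lemma mon_update: "i < length c \<Longrightarrow> mon a (c[i := Suc (c ! i)]) = X (Suc (a + i)) * mon a c"
  by (induction c arbitrary: a i) (auto split: nat.split)

lemma mon_zeros [simp]: "mon a (replicate n 0) = 1"
  by (induction n arbitrary: a) auto

lemma qX_neq_X [simp]: "i \<noteq> j \<Longrightarrow> C q * X i \<noteq> X j"
  using qX_minus_X_nonzero by fastforce

lemma Dn_1 [simp]: "Dn a (Suc 0) = 1"
  by (simp add: Dn_def)

lemma Dn_Suc: "Dn a (Suc (Suc n)) = Dn a (Suc n) * (C q * X (a + Suc n) - X (Suc (a + Suc n)))"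
  by (simp add: Dn_def)

lemma Dn_add:
  "Dn a (Suc i + Suc m) = Dn a (Suc i) * (C q * X (a + Suc i) - X (Suc (a + Suc i))) * Dn (a + Suc i) (Suc m)"
proof (induction m)
  case (Suc m)
  have "Dn a (Suc i + Suc (Suc m)) = Dn a (Suc (Suc (i + Suc m)))" by simp
  also have "\<dots> = Dn a (Suc i + Suc m) * (C q * X (a + Suc i + Suc m) - X (Suc (a + Suc i + Suc m)))"
    unfolding Dn_Suc by (simp add: add.assoc)
  finally show ?case unfolding Suc Dn_Suc by (simp only: mult.assoc)
qed (simp add: Dn_Suc)

lemma s_mon: "j < a \<or> a + length c < j \<Longrightarrow> s j (mon a c) = mon a c"
  by (induction c arbitrary: a) (auto simp: s_mult s_power swp_def)

lemma s_Dn: "j < a \<or> a + n < j \<Longrightarrow> s j (Dn a n) = Dn a n"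
  unfolding Dn_def s_prod by (intro prod.cong refl) (auto simp: s_mult s_diff swp_def)

text \<open>Up to the factor [m]! the symmetrizer of the second block may be inserted, and A passes
  through it; the same is then done for the first block. The value for A is demanded only when
  \<beta> is nonzero because in the application it is known only when its degree is small
  enough.\<close>

lemma Sy_block:
  assumes B: "Sy (a + i) m B = C \<beta>" and A: "\<beta> \<noteq> 0 \<Longrightarrow> Sy a i A = C \<alpha>"
    and fixA: "\<And>j. 1 \<le> j \<Longrightarrow> j < m \<Longrightarrow> s (a + i + j) A = A"
  shows "Sy a (i + m) (A * B) = C (qbin q i m * \<alpha> * \<beta>)"
proof -
  note qf = qfact_nonzero[OF qint_nonzero]
  have "C (qfact q m) * Sy a (i + m) (A * B) = Sy a (i + m) (Sy (a + i) m (A * B))"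
    by (simp add: Sy_Sy)
  also have "Sy (a + i) m (A * B) = A * C \<beta>"
    using Sy_scale[of m "a + i" A B] fixA B by simp
  also have "Sy a (i + m) (A * C \<beta>) = C \<beta> * Sy a (i + m) A"
    by (simp only: Sy_C mult.commute[of A])
  also have "\<dots> = C (\<alpha> * \<beta> * qfact q (i + m) / qfact q i)"
  proof (cases "\<beta> = 0")
    case False
    have "C (qfact q i) * Sy a (i + m) A = Sy a (i + m) (Sy a i A)"
      by (simp add: Sy_Sy)
    also have "\<dots> = C \<alpha> * C (qfact q (i + m))"
      using A[OF False] Sy_C[of a "i + m" \<alpha> 1] by (simp add: Sy_1)
    finally have "C (qfact q i) * Sy a (i + m) A = C (qfact q i) * C (\<alpha> * qfact q (i + m) / qfact q i)"
      using qf by (simp flip: C_mult)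
    then have "Sy a (i + m) A = C (\<alpha> * qfact q (i + m) / qfact q i)" using qf by simp
    then show ?thesis by (simp add: mult_ac flip: C_mult)
  qed simp
  also have "\<dots> = C (qfact q m) * C (qbin q i m * \<alpha> * \<beta>)"
    using qf by (simp add: qbin_def field_simps flip: C_mult)
  finally show ?thesis using qf by simp
qed

text \<open>Covers a second block whose degree is too large for its value to be known to be a
  scalar: the first block annihilates the product by itself.\<close>

lemma Sy_block_zero:
  assumes "Sy a i A = 0" "\<And>j. 1 \<le> j \<Longrightarrow> j < i \<Longrightarrow> s (a + j) B = B"
  shows "Sy a (i + m) (A * B) = 0"
proof -
  have "C (qfact q i) * Sy a (i + m) (A * B) = Sy a (i + m) (Sy a i (B * A))"
    by (simp add: Sy_Sy mult.commute)
  also have "\<dots> = 0" using assms Sy_scale[of i a B A] by simp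
  finally show ?thesis using qfact_nonzero[OF qint_nonzero] by simp
qed

text \<open>The factor q x_i - x_(i+1) removes the one denominator that links the blocks, leaving a
  product of the two block quotients.\<close>

lemma F_relation:
  assumes IH: "\<And>a c. c \<noteq> [] \<Longrightarrow> length c \<le> Suc (length us + length vs) \<Longrightarrow> sum_list c < length c \<Longrightarrow> F a c = C (Psi q c)"
    and deg: "sum_list (us @ x # y # vs) \<le> length us + length vs"
  shows "C q * F a (us @ Suc x # y # vs) - F a (us @ x # Suc y # vs)
    = C (qbin q (Suc (length us)) (Suc (length vs)) * psi q (length us) (us @ [x]) * psi q (length vs) (y # vs))"
proof -
  let ?i = "Suc (length us)" and ?m = "Suc (length vs)"
  let ?A = "mon a (us @ [x])" and ?B = "mon (a + ?i) (y # vs)"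
  let ?d = "C q * X (a + ?i) - X (Suc (a + ?i))"
  have d: "?d \<noteq> 0" by simp
  have len: "length (us @ z # w # vs) = ?i + ?m" for z w by simp
  have m1: "mon a (us @ Suc x # y # vs) = X (a + ?i) * (?A * ?B)"
    and m2: "mon a (us @ x # Suc y # vs) = X (Suc (a + ?i)) * (?A * ?B)"
    by (simp_all add: mon_append)
  have "C q * F a (us @ Suc x # y # vs) - F a (us @ x # Suc y # vs)
    = Sy a (?i + ?m) (C q * (X (a + ?i) * (?A * ?B) / Dn a (?i + ?m)) - X (Suc (a + ?i)) * (?A * ?B) / Dn a (?i + ?m))"
    unfolding F_def len m1 m2 Sy_diff Sy_C ..
  also have "C q * (X (a + ?i) * (?A * ?B) / Dn a (?i + ?m)) - X (Suc (a + ?i)) * (?A * ?B) / Dn a (?i + ?m)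
    = ?d * (?A * ?B) / Dn a (?i + ?m)"
    by (simp only: left_diff_distrib diff_divide_distrib mult.assoc times_divide_eq_right)
  also have "\<dots> = (?A / Dn a ?i) * (?B / Dn (a + ?i) ?m)"
    unfolding Dn_add using d by (simp add: mult_ac)
  also have "Sy a (?i + ?m) \<dots> = C (qbin q ?i ?m * psi q (length us) (us @ [x]) * psi q (length vs) (y # vs))"
  proof -
    have B: "Sy (a + ?i) ?m (?B / Dn (a + ?i) ?m) = F (a + ?i) (y # vs)" by (simp add: F_def)
    have A: "Sy a ?i (?A / Dn a ?i) = F a (us @ [x])" by (simp add: F_def)
    show ?thesis
    \<comment> \<open>The hypothesis \<open>IH\<close> reaches only degrees below the number of
      variables. If the right block is within range and nonzero, its degree is exactly
      \<open>length vs\<close>, which brings the left block into range; otherwise the left degree is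
      so small that the left block vanishes.\<close>
    proof (cases "sum_list (y # vs) \<le> length vs")
      case True
      show ?thesis
      proof (rule Sy_block)
        show "Sy (a + ?i) ?m (?B / Dn (a + ?i) ?m) = C (psi q (length vs) (y # vs))"
          unfolding B using True IH[of "y # vs" "a + ?i"] by simp
        show "Sy a ?i (?A / Dn a ?i) = C (psi q (length us) (us @ [x]))" if "psi q (length vs) (y # vs) \<noteq> 0"
        proof -
          have "sum_list (y # vs) = length vs" using psi_degree[of "y # vs" "length vs" q] that by auto
          then show ?thesis unfolding A using deg IH[of "us @ [x]" a] by simp
        qed
        show "s (a + ?i + j) (?A / Dn a ?i) = ?A / Dn a ?i" if "1 \<le> j" "j < ?m" for j
          using that by (simp add: s_divide s_mon s_Dn)
      qed
    next
      case False
      then have small: "sum_list (us @ [x]) < length us" using deg by simp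
      then have zero: "psi q (length us) (us @ [x]) = 0" by (intro psi_degree) auto
      have "Sy a (?i + ?m) ((?A / Dn a ?i) * (?B / Dn (a + ?i) ?m)) = 0"
      proof (rule Sy_block_zero)
        show "Sy a ?i (?A / Dn a ?i) = 0"
          unfolding A using small zero IH[of "us @ [x]" a] by simp
        show "s (a + j) (?B / Dn (a + ?i) ?m) = ?B / Dn (a + ?i) ?m" if "1 \<le> j" "j < ?i" for j
          using that s_mon[of "a + j" "a + ?i" "y # vs"] s_Dn[of "a + j" "a + ?i" ?m]
          by (simp add: s_divide del: mon.simps)
      qed
      then show ?thesis by (simp add: zero)
    qed
  qed
  finally show ?thesis .
qed

lemma T_antisym:
  assumes "s j y = y"
  shows "T j (y / (C q * X j - X (Suc j))) = - (y / (C q * X j - X (Suc j)))"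
proof -
  define d e f where "d = X j - X (Suc j)" "e = C q * X j - X (Suc j)" "f = C q * X (Suc j) - X j"
  have nz: "d \<noteq> 0" "e \<noteq> 0" "f \<noteq> 0" by (simp_all add: d_e_f_def)
  have be: "be j (Suc j) = - (f / d)"
    unfolding be_def d_e_f_def minus_divide_left minus_diff_eq ..
  have "s j (y / e) = y / f"
    using assms by (simp add: d_e_f_def s_divide s_diff s_mult swp_def)
  then have "T j (y / e) = ((C q - 1) * X j / d) * (y / e) + (- (f / d)) * (y / f)"
    unfolding T_eq d_e_f_def(2)[symmetric] be by (simp add: al_def d_e_f_def(1))
  also have "\<dots> = ((C q - 1) * X j - e) * y / (d * e)"
    using nz by (simp add: field_simps)
  also have "(C q - 1) * X j - e = - d" by (simp add: d_e_f_def algebra_simps)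
  finally show ?thesis using nz by (simp add: d_e_f_def(2))
qed

text \<open>By \<open>T_antisym\<close> the argument is an eigenvector of T_j for -1, while the
  symmetrizer turns T_j into q; hence (1 + q) times the result is 0.\<close>

lemma Sy_eq_0:
  assumes "1 \<le> j" "j < n" "s (a + j) y = y"
  shows "Sy a n (y / (C q * X (a + j) - X (Suc (a + j)))) = 0" (is "Sy a n ?x = 0")
proof -
  have "C q * Sy a n ?x = Sy a n (C (-1) * ?x)"
    using Sy_T[OF assms(1,2), of a ?x] T_antisym[OF assms(3)] C_diff[of 0 1] by simp
  also have "\<dots> = C (-1) * Sy a n ?x" by (rule Sy_C)
  also have "C (-1) = - 1" using C_diff[of 0 1] by simp
  finally have "C (qint q (Suc 1)) * Sy a n ?x = 0"
    by (simp add: qint_def C_add algebra_simps)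
  then show ?thesis using qint_nonzero[of 1] by simp
qed

lemma C_qint: "C (qint q n) = qint (C q) n"
  by (simp add: qint_def C_sum C_power)

lemma Sy_inverse_Dn_2: "Sy a 2 (1 / Dn a 2) = 0"
proof -
  have "Dn a 2 = C q * X (a + 1) - X (Suc (a + 1))" using Dn_Suc[of a 0] by (simp add: numeral_2_eq_2)
  then show ?thesis using Sy_eq_0[of 1 2 a 1] by simp
qed

text \<open>Expanding by q x - z splits 1 / ((q x - y)(q y - z)) into two fractions. The first is
  symmetric in y, z apart from the factor 1 / (q y - z), the second in x, y apart from 1 / (q x -
  y), so \<open>Sy_eq_0\<close> kills both.\<close>

lemma Sy_inverse_Dn_3: "Sy a 3 (1 / Dn a 3) = 0"
proof -
  let ?x = "X (a + 1)" and ?y = "X (a + 2)" and ?z = "X (a + 3)"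
  let ?u = "C q * ?x - ?y" and ?v = "C q * ?y - ?z" and ?w = "C q * ?x - ?z"
  have nz: "?u \<noteq> 0" "?v \<noteq> 0" "?w \<noteq> 0" by simp_all
  have D: "Dn a 3 = ?u * ?v"
    using Dn_Suc[of a 1] Dn_Suc[of a 0] by (simp add: numeral_3_eq_3 numeral_2_eq_2)
  have "1 / (?u * ?v) = ?w / (?w * (?u * ?v))" using nz by simp
  also have "\<dots> = (C q * ?x / (?u * ?w)) / ?v - (?z / (?w * ?v)) / ?u"
    by (simp add: diff_divide_distrib mult_ac)
  finally have "1 / Dn a 3 = (C q * ?x / (?u * ?w)) / ?v - (?z / (?w * ?v)) / ?u" unfolding D .
  moreover have "Sy a 3 ((C q * ?x / (?u * ?w)) / ?v) = 0"
    using Sy_eq_0[of 2 3 a "C q * ?x / (?u * ?w)"]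
    by (simp add: s_divide s_mult s_diff swp_def mult.commute eval_nat_numeral)
  moreover have "Sy a 3 ((?z / (?w * ?v)) / ?u) = 0"
    using Sy_eq_0[of 1 3 a "?z / (?w * ?v)"]
    by (simp add: s_divide s_mult s_diff swp_def mult.commute eval_nat_numeral)
  ultimately show ?thesis by (simp add: Sy_diff)
qed

lemma s_power_sum:
  assumes "1 \<le> j" "j < n"
  shows "s (a + j) (\<Sum>i<n. X (Suc (a + i)) ^ k) = (\<Sum>i<n. X (Suc (a + i)) ^ k)"
proof -
  have "s (a + j) (\<Sum>i<n. X (Suc (a + i)) ^ k) = (\<Sum>i<n. X (Suc (a + swp (j - 1) i)) ^ k)"
    unfolding s_sum by (intro sum.cong refl) (use assms in \<open>auto simp: s_power swp_def\<close>)
  also have "\<dots> = (\<Sum>i<n. X (Suc (a + i)) ^ k)"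
    by (rule sum.reindex_bij_witness[of _ "swp (j - 1)" "swp (j - 1)"])
      (use assms in \<open>auto simp: swp_def\<close>)
  finally show ?thesis .
qed

text \<open>The transpositions beyond position a + n replace the last variable x by fresh ones y and
  z. Subtracting the resulting equations gives \<alpha> (x + y) = \<beta> (2 E + x + y) and then
  \<alpha> = \<beta>, so the sum E of the other variables would be 0.\<close>

lemma power_sums_independent:
  assumes n: "n \<ge> 3" and eq: "\<alpha> * (\<Sum>i<n. X (Suc (a + i)) ^ 2) = \<beta> * (\<Sum>i<n. X (Suc (a + i))) ^ 2"
    and fixed: "\<And>j. s j \<alpha> = \<alpha>" "\<And>j. s j \<beta> = \<beta>"
  shows "\<alpha> = 0"
proof (rule ccontr)
  assume \<alpha>: "\<alpha> \<noteq> 0"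
  have C2: "C 2 = 2" using C_add[of 1 1] by simp
  then have two: "s j 2 = 2" for j using s_C[of j 2] by simp
  define k where "k = n - 2"
  have k: "n = Suc (Suc k)" using n by (simp add: k_def)
  let ?m = "Suc (Suc (a + k))"
  let ?x = "X ?m" and ?y = "X (Suc ?m)" and ?z = "X (Suc (Suc ?m))"
  define P E where "P = (\<Sum>i<Suc k. X (Suc (a + i)) ^ 2)" "E = (\<Sum>i<Suc k. X (Suc (a + i)))"
  have sP: "s j P = P" and sE: "s j E = E" if "j \<ge> ?m" for j
    using that unfolding P_E_def s_sum by (auto intro!: sum.cong simp: s_power swp_def)
  have e1: "\<alpha> * (P + ?x ^ 2) = \<beta> * (E + ?x) ^ 2" using eq unfolding k P_E_def by simp
  have "s ?m (\<alpha> * (P + ?x ^ 2)) = s ?m (\<beta> * (E + ?x) ^ 2)" by (simp only: e1)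
  then have e2: "\<alpha> * (P + ?y ^ 2) = \<beta> * (E + ?y) ^ 2"
    by (simp add: s_mult s_add s_power fixed sP sE swp_def)
  have "(?x - ?y) * (\<alpha> * (?x + ?y)) = \<alpha> * (P + ?x ^ 2) - \<alpha> * (P + ?y ^ 2)"
    by (simp add: algebra_simps power2_eq_square)
  also have "\<dots> = (?x - ?y) * (\<beta> * (2 * E + ?x + ?y))"
    unfolding e1 e2 by (simp add: algebra_simps power2_eq_square)
  finally have e3: "\<alpha> * (?x + ?y) = \<beta> * (2 * E + ?x + ?y)" by simp
  have "s (Suc ?m) (\<alpha> * (?x + ?y)) = s (Suc ?m) (\<beta> * (2 * E + ?x + ?y))" by (simp only: e3)
  then have e4: "\<alpha> * (?x + ?z) = \<beta> * (2 * E + ?x + ?z)"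
    by (simp add: s_mult s_add fixed sE swp_def two)
  have "\<alpha> * (?y - ?z) = \<alpha> * (?x + ?y) - \<alpha> * (?x + ?z)" by (simp add: algebra_simps)
  also have "\<dots> = \<beta> * (?y - ?z)" unfolding e3 e4 by (simp add: algebra_simps)
  finally have "\<alpha> = \<beta>" by simp
  with e3 \<alpha> have "C 2 * E = 0" by (simp add: C2 algebra_simps)
  then have E: "E = 0" by simp
  define E' where "E' = (\<Sum>i<k. X (Suc (a + i)))"
  have E': "E = E' + X (Suc (a + k))" by (simp add: P_E_def E'_def)
  have "s (Suc (a + k)) E' = E'" unfolding E'_def s_sum by (auto intro!: sum.cong simp: swp_def)
  then have "s (Suc (a + k)) E = E' + ?x" unfolding E' by (simp add: s_add swp_def)
  then have "X (Suc (a + k)) = ?x" using E E' by (metis add_left_cancel s_0)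
  then show False by simp
qed

text \<open>The degree is one too small for both blocks to have the degree at which psi can be
  nonzero, so the right-hand side of \<open>F_relation\<close> vanishes for every adjacent
  pair.\<close>

lemma F_geometric:
  assumes IH: "\<And>a c. c \<noteq> [] \<Longrightarrow> length c < n \<Longrightarrow> sum_list c < length c \<Longrightarrow> F a c = C (Psi q c)"
    and c: "length c = n" "sum_list c + 3 \<le> n" and i: "i < n"
  shows "F a (c[i := Suc (c ! i)]) = C q ^ i * F a (c[0 := Suc (c ! 0)])"
  using i
proof (induction i)
  case (Suc i)
  define us x y vs where "us = take i c" "x = c ! i" "y = c ! Suc i" "vs = drop (Suc (Suc i)) c"
  have i: "Suc i < length c" using Suc.prems c by simp
  then have split: "c = us @ x # y # vs"
    unfolding us_x_y_vs_def by (simp add: Cons_nth_drop_Suc)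
  have len: "length us = i" using i by (simp add: us_x_y_vs_def)
  have n: "n = Suc (Suc (length us + length vs))" using c split by simp
  have "psi q (length us) (us @ [x]) = 0 \<or> psi q (length vs) (y # vs) = 0"
    using psi_degree[of "us @ [x]" "length us" q] psi_degree[of "y # vs" "length vs" q] c(2) n split
    by fastforce
  then have "C q * F a (us @ Suc x # y # vs) - F a (us @ x # Suc y # vs) = 0"
    using F_relation[of us vs x y a] IH c n split by auto
  moreover have "c[i := Suc (c ! i)] = us @ Suc x # y # vs" "c[Suc i := Suc (c ! Suc i)] = us @ x # Suc y # vs"
    using len by (auto simp: split list_update_append nth_append)
  ultimately show ?case using Suc by (simp add: mult.assoc)
qed simp

lemma F_e1:
  assumes "length c = n"
  shows "(\<Sum>i<n. F a (c[i := Suc (c ! i)])) = (\<Sum>i<n. X (Suc (a + i))) * F a c"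
proof -
  have "(\<Sum>i<n. F a (c[i := Suc (c ! i)])) = Sy a n (\<Sum>i<n. X (Suc (a + i)) * (mon a c / Dn a n))"
    unfolding Sy_sum by (intro sum.cong refl) (simp add: F_def assms mon_update)
  also have "\<dots> = Sy a n ((\<Sum>i<n. X (Suc (a + i)) ^ 1) * (mon a c / Dn a n))"
    by (simp only: sum_distrib_right power_one_right)
  also have "\<dots> = (\<Sum>i<n. X (Suc (a + i)) ^ 1) * Sy a n (mon a c / Dn a n)"
    by (rule Sy_scale) (rule s_power_sum)
  finally show ?thesis by (simp add: F_def assms)
qed

text \<open>For \<open>n \<ge> 4\<close>, the values at \<open>e\<^sub>i\<close> and at \<open>e\<^sub>j + e\<^sub>i\<close> are geometric progressions in \<open>i\<close>; summing
  them shows that \<open>p\<^sub>2 * F 0\<close> and \<open>p\<^sub>1\<^sup>2 * F 0\<close> are proportional, which forces \<open>F 0 = 0\<close>.\<close>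

lemma F_zeros:
  assumes IH: "\<And>a c. c \<noteq> [] \<Longrightarrow> length c < n \<Longrightarrow> sum_list c < length c \<Longrightarrow> F a c = C (Psi q c)"
    and n: "n \<ge> 2"
  shows "F a (replicate n 0) = 0"
proof -
  define Z where "Z = F a (replicate n 0)"
  have Z: "Z = Sy a n (1 / Dn a n)" by (simp add: Z_def F_def)
  \<comment> \<open>The progressions starting from the exponents of x_j need 1 + 3 <= n, which is
    why n = 2 and n = 3 are settled by explicit partial fractions.\<close>
  consider "n = 2" | "n = 3" | "n \<ge> 4" using n by linarith
  then have "Z = 0"
  proof cases
    case 3
    let ?e = "\<lambda>i. (replicate n 0)[i := Suc 0]" and ?N = "C (qint q n)"
    define e1 where "e1 = (\<Sum>i<n. X (Suc (a + i)))"
    have N: "?N \<noteq> 0" using qint_nonzero[of "n - 1"] n by simp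
    have geo: "e1 * F a c = ?N * F a (c[0 := Suc (c ! 0)])" if c: "length c = n" "sum_list c + 3 \<le> n" for c
    proof -
      have "e1 * F a c = (\<Sum>i<n. F a (c[i := Suc (c ! i)]))" by (simp add: e1_def F_e1 c)
      also have "\<dots> = (\<Sum>i<n. C q ^ i * F a (c[0 := Suc (c ! 0)]))"
        by (intro sum.cong refl F_geometric[OF IH c]) auto
      finally show ?thesis unfolding C_qint unfolding qint_def sum_distrib_right .
    qed
    have len: "length (?e j) = n" and sum: "j < n \<Longrightarrow> sum_list (?e j) = 1" for j
      by (simp_all add: sum_list_update sum_list_replicate)
    have A: "F a (?e i) = C q ^ i * F a (?e 0)" if "i < n" for i
      using F_geometric[where n = n and c = "replicate n 0" and i = i and a = a, OF IH] that 3 by (simp add: sum_list_replicate)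
    have A0: "e1 * Z = ?N * F a (?e 0)"
      using geo[of "replicate n 0"] 3 by (simp add: Z_def sum_list_replicate)
    \<comment> \<open>The exponent 2 e_j is reached through e_j + e_0: each of the two steps
      contributes a factor q^j and one factor \<open>e1\<close>, at the price of one factor
      [n].\<close>
    have B: "?N * (?N * F a ((?e j)[j := Suc (?e j ! j)])) = C q ^ j * C q ^ j * (e1 * (e1 * Z))" if j: "j < n" for j
    proof -
      have "?N * (?N * F a ((?e j)[j := Suc (?e j ! j)])) = ?N * (?N * (C q ^ j * F a ((?e j)[0 := Suc (?e j ! 0)])))"
        using F_geometric[where n = n and c = "?e j" and i = j and a = a, OF IH len] sum[OF j] j 3 by simp
      also have "\<dots> = ?N * C q ^ j * (?N * F a ((?e j)[0 := Suc (?e j ! 0)]))" by (simp add: mult_ac)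
      also have "\<dots> = ?N * C q ^ j * (e1 * F a (?e j))"
        using geo[of "?e j", OF len] sum[OF j] 3 by simp
      also have "\<dots> = C q ^ j * C q ^ j * (e1 * (?N * F a (?e 0)))" by (simp add: A[OF j] mult_ac)
      finally show ?thesis by (simp only: A0)
    qed
    have p2: "(\<Sum>j<n. F a ((?e j)[j := Suc (?e j ! j)])) = (\<Sum>i<n. X (Suc (a + i)) ^ 2) * Z"
    proof -
      have "(\<Sum>j<n. F a ((?e j)[j := Suc (?e j ! j)])) = Sy a n (\<Sum>i<n. X (Suc (a + i)) ^ 2 * (1 / Dn a n))"
        unfolding Sy_sum
      proof (intro sum.cong refl)
        fix j assume j: "j \<in> {..<n}"
        then have "mon a ((?e j)[j := Suc (?e j ! j)]) = X (Suc (a + j)) ^ 2"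
          using mon_update[of j "?e j" a] mon_update[of j "replicate n 0" a] by (simp add: power2_eq_square)
        then show "F a ((?e j)[j := Suc (?e j ! j)]) = Sy a n (X (Suc (a + j)) ^ 2 * (1 / Dn a n))"
          by (simp add: F_def)
      qed
      also have "\<dots> = Sy a n ((\<Sum>i<n. X (Suc (a + i)) ^ 2) * (1 / Dn a n))"
        by (simp only: sum_distrib_right)
      also have "\<dots> = (\<Sum>i<n. X (Suc (a + i)) ^ 2) * Sy a n (1 / Dn a n)"
        by (rule Sy_scale) (rule s_power_sum)
      finally show ?thesis by (simp add: Z)
    qed
    show "Z = 0"
    proof (rule ccontr)
      assume "Z \<noteq> 0"
      let ?\<beta> = "C (\<Sum>j<n. q ^ j * q ^ j)"
      have "?N * ?N * (\<Sum>i<n. X (Suc (a + i)) ^ 2) * Z = (\<Sum>j<n. ?N * (?N * F a ((?e j)[j := Suc (?e j ! j)])))"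
        unfolding sum_distrib_left[symmetric] p2 by (simp only: mult.assoc)
      also have "\<dots> = (\<Sum>j<n. C q ^ j * C q ^ j * (e1 * (e1 * Z)))"
        by (intro sum.cong refl B) simp
      also have "\<dots> = ?\<beta> * e1 ^ 2 * Z"
        by (simp add: C_sum C_mult C_power sum_distrib_right power2_eq_square mult.assoc)
      finally have "?N * ?N * (\<Sum>i<n. X (Suc (a + i)) ^ 2) = ?\<beta> * e1 ^ 2"
        using \<open>Z \<noteq> 0\<close> by simp
      then have "?N * ?N = 0"
        unfolding e1_def by (rule power_sums_independent[rotated]) (use 3 in \<open>auto simp: s_mult\<close>)
      with N show False by simp
    qed
  qed (simp_all add: Z Sy_inverse_Dn_2 Sy_inverse_Dn_3)
  then show ?thesis by (simp add: Z_def)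
qed

text \<open>Outer induction on the number of variables, inner on the degree. A nonconstant monomial
  is written as x_j times a monomial \<open>b\<close>, and all x_i b are treated together.\<close>

theorem F_eq_psi: "length c = Suc n \<Longrightarrow> sum_list c \<le> n \<Longrightarrow> F a c = C (psi q n c)"
proof (induction n arbitrary: a c rule: less_induct)
  case (less n)
  show ?case
  proof (cases n)
    case 0
    with less.prems have "c = [0]" by (auto simp: length_Suc_conv)
    then show ?thesis using Sy_1[of a 1] 0 by (simp add: F_def qfact_def)
  next
    case (Suc k)
    have IH: "F a c = C (Psi q c)" if "c \<noteq> []" "length c < Suc n" "sum_list c < length c" for a c
      using less.IH[of "length c - 1" c a] that by (cases c) auto
    have main: "length c = Suc n \<Longrightarrow> sum_list c \<le> n \<Longrightarrow> F a c = C (psi q n c)" for c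
    proof (induction "sum_list c" arbitrary: c)
      case 0
      then have c: "c = replicate (Suc n) 0" by (intro replicate_eqI) auto
      have "F a c = 0" unfolding c using IH Suc by (intro F_zeros) auto
      moreover have "psi q n c = 0" unfolding c using Suc by (intro psi_degree) (auto simp: sum_list_replicate)
      ultimately show ?case by simp
    next
      case (Suc d)
      from Suc.hyps(2) have "\<exists>j<length c. c ! j \<noteq> 0"
        by (metis in_set_conv_nth less_numeral_extra(3) sum_list_eq_0_iff zero_less_Suc)
      then obtain j where j: "j < Suc n" "c ! j \<noteq> 0" using Suc.prems(1) by auto
      define b where "b = c[j := c ! j - 1]"
      have b: "length b = Suc n" "c = b[j := Suc (b ! j)]" using j Suc.prems(1) by (auto simp: b_def)
      have sb: "sum_list b = d"
        using Suc.hyps(2) sum_list_update[of j b "Suc (b ! j)"] b j by simp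
      let ?d = "\<lambda>i. F a (b[i := Suc (b ! i)]) - C (psi q n (b[i := Suc (b ! i)]))"
      have "?d j = 0"
      proof (rule geometric_zero[of "Suc n" ?d "C q"])
        show "?d (Suc i) = C q * ?d i" if "Suc i < Suc n" for i
        proof -
          define us x y vs where "us = take i b" "x = b ! i" "y = b ! Suc i" "vs = drop (Suc (Suc i)) b"
          have split: "b = us @ x # y # vs"
            unfolding us_x_y_vs_def using that b by (simp add: Cons_nth_drop_Suc)
          have len: "length us = i" using that b by (simp add: us_x_y_vs_def)
          have n: "n = Suc (length us + length vs)" using b split by simp
          have "C q * F a (us @ Suc x # y # vs) - F a (us @ x # Suc y # vs)
            = C (q * psi q n (us @ Suc x # y # vs) - psi q n (us @ x # Suc y # vs))"
            unfolding n psi_relation[OF qint_nonzero refl]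
            by (rule F_relation) (use IH n sb Suc.hyps(2) Suc.prems split in auto)
          moreover have "b[i := Suc (b ! i)] = us @ Suc x # y # vs" "b[Suc i := Suc (b ! Suc i)] = us @ x # Suc y # vs"
            using len by (auto simp: split list_update_append nth_append)
          ultimately show ?thesis by (simp add: C_diff C_mult algebra_simps)
        qed
        \<comment> \<open>\<open>b\<close> has degree below n, so the inner induction hypothesis
          identifies its bracket with a value of psi that is 0 by degree.\<close>
        have "F a b = 0"
          using Suc.hyps(1)[of b] Suc.hyps(2) Suc.prems b sb psi_degree[of b n q] by simp
        then have "(\<Sum>i<Suc n. F a (b[i := Suc (b ! i)])) = 0"
          unfolding F_e1[OF b(1)] by simp
        moreover have "(\<Sum>i<Suc n. C (psi q n (b[i := Suc (b ! i)]))) = 0"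
          unfolding C_sum[symmetric] psi_e1[OF b(1)] by simp
        ultimately show "(\<Sum>i<Suc n. ?d i) = 0"
          unfolding sum_subtractf by simp
        show "qint (C q) (Suc n) \<noteq> 0" using qint_nonzero[of n] unfolding C_qint[symmetric] by simp
      qed (rule j(1))
      then show ?case using b(2) by simp
    qed
    show ?thesis using main less.prems by blast
  qed
qed

end

section \<open>Polynomials and the quasisymmetric ideal\<close>

lemma inj_swp: "inj (swp j)"
  by (rule bij_is_inj) simp

abbreviation swp_exp :: "nat \<Rightarrow> (nat \<Rightarrow>\<^sub>0 nat) \<Rightarrow> (nat \<Rightarrow>\<^sub>0 nat)" where
  "swp_exp j \<equiv> Poly_Mapping.map_key (swp j)"

lemma lookup_swp_exp [simp]: "Poly_Mapping.lookup (swp_exp j m) i = Poly_Mapping.lookup m (swp j i)"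
  by (simp add: map_key.rep_eq inj_swp)

lemma swp_exp_swp_exp [simp]: "swp_exp j (swp_exp j m) = m"
  by (rule poly_mapping_eqI) simp

lemma swp_exp_0 [simp]: "swp_exp j 0 = 0"
  by (rule poly_mapping_eqI) simp

lemma inj_swp_exp: "inj (swp_exp j)"
  by (rule inj_on_inverseI[of _ "swp_exp j"]) simp

lemma swp_exp_add: "swp_exp j (m + m') = swp_exp j m + swp_exp j m'"
  by (rule poly_mapping_eqI) (simp add: lookup_add)

lemma lookup_swap_poly [simp]: "Poly_Mapping.lookup (swap_poly j p) m = Poly_Mapping.lookup p (swp_exp j m)"
  by (simp add: swap_poly_def map_key.rep_eq inj_swp_exp)

lemma swap_poly_swap_poly [simp]: "swap_poly j (swap_poly j p) = p"
  by (rule poly_mapping_eqI) simp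

lemma swap_poly_add: "swap_poly j (p + r) = swap_poly j p + swap_poly j r"
  by (rule poly_mapping_eqI) (simp add: lookup_add)

lemma swap_poly_0 [simp]: "swap_poly j 0 = 0"
  by (rule poly_mapping_eqI) simp

lemma swap_poly_sum: "swap_poly j (sum f A) = (\<Sum>i\<in>A. swap_poly j (f i))"
  by (induction A rule: infinite_finite_induct) (auto simp: swap_poly_add)

lemma swap_poly_eq_0_iff [simp]: "swap_poly j p = 0 \<longleftrightarrow> p = 0"
  by (metis swap_poly_0 swap_poly_swap_poly)

lemma swap_poly_single: "swap_poly j (Poly_Mapping.single m c) = Poly_Mapping.single (swp_exp j m) c"
proof (rule poly_mapping_eqI)
  fix m'
  have "m = swp_exp j m' \<longleftrightarrow> swp_exp j m = m'" by (metis swp_exp_swp_exp)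
  then show "Poly_Mapping.lookup (swap_poly j (Poly_Mapping.single m c)) m' =
      Poly_Mapping.lookup (Poly_Mapping.single (swp_exp j m) c) m'"
    by (simp add: lookup_single)
qed

lemma poly_eq_sum_single:
  fixes p :: "'a \<Rightarrow>\<^sub>0 'b::comm_monoid_add"
  assumes "finite A" "Poly_Mapping.keys p \<subseteq> A"
  shows "p = (\<Sum>m\<in>A. Poly_Mapping.single m (Poly_Mapping.lookup p m))"
proof (rule poly_mapping_eqI)
  fix k
  have "Poly_Mapping.lookup (\<Sum>m\<in>A. Poly_Mapping.single m (Poly_Mapping.lookup p m)) k
    = (\<Sum>m\<in>A. if m = k then Poly_Mapping.lookup p k else 0)"
    unfolding lookup_sum by (intro sum.cong refl) (simp add: lookup_single when_def)
  also have "\<dots> = Poly_Mapping.lookup p k"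
    using assms by (auto simp: in_keys_iff)
  finally show "Poly_Mapping.lookup p k = Poly_Mapping.lookup (\<Sum>m\<in>A. Poly_Mapping.single m (Poly_Mapping.lookup p m)) k" ..
qed

lemmas poly_eq_sum_keys = poly_eq_sum_single[OF finite_keys order.refl]

lemma mult_eq_sum_single:
  fixes a p :: "'k::comm_ring_1 mpoly"
  shows "a * p = (\<Sum>\<alpha>\<in>Poly_Mapping.keys a. \<Sum>m\<in>Poly_Mapping.keys p.
     Poly_Mapping.single (\<alpha> + m) (Poly_Mapping.lookup a \<alpha> * Poly_Mapping.lookup p m))"
  by (subst poly_eq_sum_keys[of a], subst poly_eq_sum_keys[of p]) (simp add: sum_product mult_single)

lemma swap_poly_mult: "swap_poly j (a * p) = swap_poly j a * swap_poly j (p :: 'k::comm_ring_1 mpoly)"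
proof -
  have "swap_poly j a = (\<Sum>\<alpha>\<in>Poly_Mapping.keys a. Poly_Mapping.single (swp_exp j \<alpha>) (Poly_Mapping.lookup a \<alpha>))" for a :: "'k mpoly"
    by (subst poly_eq_sum_keys[of a]) (simp only: swap_poly_sum swap_poly_single)
  then show ?thesis
    by (subst mult_eq_sum_single) (simp add: swap_poly_sum swap_poly_single swp_exp_add sum_product mult_single)
qed

text \<open>The choice in \<open>swap_fract\<close> is unambiguous because swapping is
  multiplicative and so preserves equality of cross products.\<close>

lemma swap_fract_Fract:
  fixes a b :: "'k::idom mpoly"
  assumes "b \<noteq> 0"
  shows "swap_fract j (Fract a b) = Fract (swap_poly j a) (swap_poly j b)"
  unfolding swap_fract_def
proof (rule some_equality)
  show "\<forall>a' b'. b' \<noteq> 0 \<longrightarrow> Fract a b = Fract a' b' \<longrightarrow>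
      Fract (swap_poly j a) (swap_poly j b) = Fract (swap_poly j a') (swap_poly j b')"
    using assms by (auto simp: eq_fract simp flip: swap_poly_mult)
qed (use assms in blast)

lemma to_fract_add: "to_fract (a + b) = to_fract a + to_fract b"
  and to_fract_mult: "to_fract (a * b) = to_fract a * to_fract b"
  and to_fract_1 [simp]: "to_fract 1 = 1"
  and to_fract_eq_iff [simp]: "to_fract a = to_fract b \<longleftrightarrow> a = b"
  by (simp_all add: to_fract_def eq_fract One_fract_def)

lemma to_fract_0 [simp]: "to_fract 0 = 0"
  by (simp add: to_fract_def Zero_fract_def)

lemma to_fract_diff: "to_fract (a - b) = to_fract a - to_fract b"
  by (simp add: to_fract_def)

lemma to_fract_sum: "to_fract (sum f A) = (\<Sum>i\<in>A. to_fract (f i))"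
  by (induction A rule: infinite_finite_induct) (auto simp: to_fract_add)

lemma to_fract_prod: "to_fract (prod f A) = (\<Prod>i\<in>A. to_fract (f i))"
  by (induction A rule: infinite_finite_induct) (auto simp: to_fract_mult)

lemma to_fract_power: "to_fract (a ^ n) = to_fract a ^ n"
  by (induction n) (auto simp: to_fract_mult)

lemma swap_fract_to_fract: "swap_fract j (to_fract p) = to_fract (swap_poly j p)"
proof -
  have "swap_poly j (1 :: 'a mpoly) = 1"
    using swap_poly_single[of j 0 "1::'a"] by (simp flip: single_one)
  then show ?thesis by (simp add: to_fract_def swap_fract_Fract)
qed

lemma qint_nonzero_of_root_condition:
  fixes q :: "'k::field_char_0"
  assumes "\<forall>m::nat. m > 0 \<longrightarrow> q ^ m = 1 \<longrightarrow> q = 1"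
  shows "qint q (Suc k) \<noteq> 0"
proof
  assume 0: "qint q (Suc k) = 0"
  have "(q - 1) * qint q n = q ^ n - 1" for n
    by (induction n) (auto simp: qint_def algebra_simps)
  from this[of "Suc k"] 0 have "q ^ Suc k = 1" by simp
  then have "q = 1" using assms by blast
  with 0 show False by (simp add: qint_def del: of_nat_Suc)
qed

lemma hecke_action_mpoly:
  fixes q :: "'k::field_char_0"
  assumes q: "\<forall>m::nat. m > 0 \<longrightarrow> q ^ m = 1 \<longrightarrow> q = 1"
  shows "hecke_action (\<lambda>c. to_fract (Poly_Mapping.single 0 c)) (\<lambda>i. to_fract (Var i)) swap_fract q"
proof
  fix c d :: 'k and i j k :: nat and x y :: "'k mpoly fract"
  show "to_fract (Poly_Mapping.single 0 (c + d)) = to_fract (Poly_Mapping.single 0 c) + (to_fract (Poly_Mapping.single 0 d) :: 'k mpoly fract)"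
    by (simp add: single_add flip: to_fract_add)
  show "to_fract (Poly_Mapping.single 0 (c * d)) = to_fract (Poly_Mapping.single 0 c) * (to_fract (Poly_Mapping.single 0 d) :: 'k mpoly fract)"
    by (simp add: mult_single flip: to_fract_mult)
  show "to_fract (Poly_Mapping.single 0 (1::'k)) = (1 :: 'k mpoly fract)" by simp
  show "swap_fract j (x + y) = swap_fract j x + swap_fract j y"
    by (cases x; cases y) (simp add: swap_fract_Fract swap_poly_add swap_poly_mult)
  show "swap_fract j (x * y) = swap_fract j x * swap_fract j y"
    by (cases x; cases y) (simp add: swap_fract_Fract swap_poly_mult)
  show "swap_fract j (to_fract (Poly_Mapping.single 0 c)) = to_fract (Poly_Mapping.single 0 c)"
    by (simp add: swap_fract_to_fract swap_poly_single)
  have "swp_exp j (Poly_Mapping.single i 1) = Poly_Mapping.single (swp j i) 1"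
  proof (rule poly_mapping_eqI)
    fix k
    have "i = swp j k \<longleftrightarrow> swp j i = k" by (metis swp_swp)
    then show "Poly_Mapping.lookup (swp_exp j (Poly_Mapping.single i 1)) k = Poly_Mapping.lookup (Poly_Mapping.single (swp j i) 1) k"
      by (simp add: lookup_single)
  qed
  then show "swap_fract j (to_fract (Var i)) = to_fract (Var (swp j i) :: 'k mpoly)"
    by (simp add: swap_fract_to_fract Var_def swap_poly_single)
  show "swap_fract j (swap_fract j x) = x"
    by (cases x) (simp add: swap_fract_Fract)
  show "swap_fract i (swap_fract j x) = swap_fract j (swap_fract i x)" if "i + 1 < j"
  proof -
    have "swp j (swp i k) = swp i (swp j k)" for k using that by (auto simp: swp_def)
    then have "swp_exp j (swp_exp i m) = swp_exp i (swp_exp j m)" for m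
      by (intro poly_mapping_eqI) simp
    then have "swap_poly i (swap_poly j p) = swap_poly j (swap_poly i p)" for p :: "'k mpoly"
      by (intro poly_mapping_eqI) simp
    then show ?thesis by (cases x) (simp add: swap_fract_Fract)
  qed
  show "swap_fract i (swap_fract (i + 1) (swap_fract i x)) = swap_fract (i + 1) (swap_fract i (swap_fract (i + 1) x))"
  proof -
    let ?j = "i + 1"
    have "swp i (swp ?j (swp i k)) = swp ?j (swp i (swp ?j k))" for k by (auto simp: swp_def)
    then have "swp_exp i (swp_exp ?j (swp_exp i m)) = swp_exp ?j (swp_exp i (swp_exp ?j m))" for m
      by (intro poly_mapping_eqI) simp
    then have "swap_poly i (swap_poly ?j (swap_poly i p)) = swap_poly ?j (swap_poly i (swap_poly ?j p))" for p :: "'k mpoly"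
      by (intro poly_mapping_eqI) simp
    then show ?thesis by (cases x) (simp add: swap_fract_Fract)
  qed
  show "i = j" if "to_fract (Var i :: 'k mpoly) = to_fract (Poly_Mapping.single 0 c) * to_fract (Var j)"
  proof -
    \<comment> \<open>Both sides are single terms, so reading off the coefficient of x_i, which is 1
      on the left, forces the monomials to coincide.\<close>
    have "Poly_Mapping.single (Poly_Mapping.single i 1) 1 = Poly_Mapping.single (Poly_Mapping.single j (1::nat)) c"
      using that by (simp add: Var_def mult_single flip: to_fract_mult)
    then have "Poly_Mapping.lookup (Poly_Mapping.single (Poly_Mapping.single j (1::nat)) c) (Poly_Mapping.single i 1) = 1"
      by (metis lookup_single_eq)
    then have "Poly_Mapping.single j (1::nat) = Poly_Mapping.single i 1"
      by (auto simp: lookup_single when_def split: if_splits)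
    then have "Poly_Mapping.lookup (Poly_Mapping.single j (1::nat)) i = 1" by simp
    then show ?thesis by (auto simp: lookup_single when_def split: if_splits)
  qed
  show "qint q (Suc k) \<noteq> 0" by (rule qint_nonzero_of_root_condition[OF q])
qed

section \<open>Exponent vectors as lists, with entry i (from 0) belonging to the variable i +
  1\<close>

definition exps :: "nat \<Rightarrow> (nat \<Rightarrow>\<^sub>0 nat) \<Rightarrow> nat list" where
  "exps n m = map (Poly_Mapping.lookup m) [1..<Suc n]"

definition of_exps :: "nat list \<Rightarrow> (nat \<Rightarrow>\<^sub>0 nat)" where
  "of_exps c = (\<Sum>i<length c. Poly_Mapping.single (Suc i) (c ! i))"

lemma length_exps [simp]: "length (exps n m) = n"
  by (simp add: exps_def)

lemma nth_exps: "i < n \<Longrightarrow> exps n m ! i = Poly_Mapping.lookup m (Suc i)"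
  by (simp add: exps_def del: upt_Suc)

lemma exps_add: "exps n (m + m') = map2 (+) (exps n m) (exps n m')"
  by (rule nth_equalityI) (auto simp: nth_exps lookup_add)

lemma lookup_of_exps:
  "Poly_Mapping.lookup (of_exps c) i = (if 1 \<le> i \<and> i \<le> length c then c ! (i - 1) else 0)"
proof -
  have "Poly_Mapping.lookup (of_exps c) i = (\<Sum>k<length c. if k = i - 1 \<and> 1 \<le> i then c ! (i - 1) else 0)"
    unfolding of_exps_def lookup_sum by (intro sum.cong refl) (auto simp: lookup_single when_def)
  then show ?thesis by (auto simp: sum.delta)
qed

lemma exps_of_exps [simp]: "exps (length c) (of_exps c) = c"
  by (rule nth_equalityI) (auto simp: nth_exps lookup_of_exps)

lemma of_exps_exps:
  assumes "Poly_Mapping.keys m \<subseteq> {1..n}"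
  shows "of_exps (exps n m) = m"
proof (rule poly_mapping_eqI)
  fix i show "Poly_Mapping.lookup (of_exps (exps n m)) i = Poly_Mapping.lookup m i"
    using assms by (auto simp: lookup_of_exps nth_exps in_keys_iff subset_iff)
qed

lemma keys_of_exps: "Poly_Mapping.keys (of_exps c) \<subseteq> {1..length c}"
  by (auto simp: in_keys_iff lookup_of_exps split: if_splits)

text \<open>Links the definition of quasisymmetry to the coefficient functions of
  \<open>nonzero\<close> lists used for trimming.\<close>

lemma exp_seq_eq:
  assumes "Poly_Mapping.keys m \<subseteq> {1..n}"
  shows "exp_seq m = nonzero (exps n m)"
proof -
  have "sorted_list_of_set (Poly_Mapping.keys m) = filter (\<lambda>i. Poly_Mapping.lookup m i \<noteq> 0) [1..<Suc n]"
    using assms by (intro sorted_distinct_set_unique) (auto simp: in_keys_iff sorted_wrt_filter simp del: upt_Suc)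
  then show ?thesis by (simp add: exp_seq_def exps_def filter_map o_def del: upt_Suc)
qed

lemma sum_exps:
  assumes "Poly_Mapping.keys m \<subseteq> {1..n}"
  shows "sum_list (exps n m) = total_deg m"
proof -
  have "sum_list (exps n m) = sum (Poly_Mapping.lookup m) {1..n}"
    by (simp only: exps_def sum_set_upt_conv_sum_list_nat[symmetric] set_upt atLeastLessThanSuc_atLeastAtMost)
  also have "\<dots> = total_deg m"
    unfolding total_deg_def using assms by (intro sum.mono_neutral_right) (auto simp: in_keys_iff)
  finally show ?thesis .
qed

section \<open>Linear extension from monomials to polynomials, and vanishing on the ideal\<close>

definition lin :: "((nat \<Rightarrow>\<^sub>0 nat) \<Rightarrow> 'k) \<Rightarrow> 'k::comm_ring_1 mpoly \<Rightarrow> 'k" where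
  "lin \<phi> p = (\<Sum>m\<in>Poly_Mapping.keys p. Poly_Mapping.lookup p m * \<phi> m)"

lemma lin_superset:
  assumes "finite A" "Poly_Mapping.keys p \<subseteq> A"
  shows "lin \<phi> p = (\<Sum>m\<in>A. Poly_Mapping.lookup p m * \<phi> m)"
  unfolding lin_def using assms by (intro sum.mono_neutral_left) (auto simp: in_keys_iff)

lemma lin_0 [simp]: "lin \<phi> 0 = 0"
  by (simp add: lin_def)

lemma lin_add: "lin \<phi> (p + r) = lin \<phi> p + lin \<phi> r"
proof -
  let ?A = "Poly_Mapping.keys p \<union> Poly_Mapping.keys r"
  have "lin \<phi> (p + r) = (\<Sum>m\<in>?A. Poly_Mapping.lookup (p + r) m * \<phi> m)"
    by (rule lin_superset) (simp_all add: Poly_Mapping.keys_add)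
  also have "\<dots> = lin \<phi> p + lin \<phi> r"
    by (simp add: lin_superset[of ?A] lookup_add distrib_right sum.distrib)
  finally show ?thesis .
qed

lemma lin_sum: "lin \<phi> (sum f A) = (\<Sum>i\<in>A. lin \<phi> (f i))"
  by (induction A rule: infinite_finite_induct) (auto simp: lin_add)

lemma lin_single [simp]: "lin \<phi> (Poly_Mapping.single m c) = c * \<phi> m"
  by (simp add: lin_def)

lemma lin_mult:
  "lin \<phi> (a * p) = (\<Sum>\<alpha>\<in>Poly_Mapping.keys a. Poly_Mapping.lookup a \<alpha> * lin (\<lambda>m. \<phi> (\<alpha> + m)) p)"
  by (subst mult_eq_sum_single) (simp add: lin_sum lin_def[of _ p] sum_distrib_left mult.assoc)

lemma lin_quasisym:
  fixes p :: "'k::comm_ring_1 mpoly"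
  assumes p: "quasisym (Suc n) p" "Poly_Mapping.lookup p 0 = 0" and a: "length a = Suc n"
  shows "lin (\<lambda>m. psi q n (map2 (+) a (exps (Suc n) m))) p = 0"
proof -
  let ?V = "\<lambda>m. Poly_Mapping.keys m \<subseteq> {1..Suc n}"
  \<comment> \<open>The coefficient of any representative with the given exponent sequence;
    quasisymmetry makes the choice irrelevant.\<close>
  define P where "P l = Poly_Mapping.lookup p (SOME m. ?V m \<and> exp_seq m = l)" for l
  have P: "P (exp_seq m) = Poly_Mapping.lookup p m" if "?V m" for m
  proof -
    have "?V (SOME m'. ?V m' \<and> exp_seq m' = exp_seq m) \<and> exp_seq (SOME m'. ?V m' \<and> exp_seq m' = exp_seq m) = exp_seq m"
      using that by (intro someI[of "\<lambda>m'. ?V m' \<and> exp_seq m' = exp_seq m" m]) simp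
    then show ?thesis using p(1) that unfolding P_def quasisym_def by blast
  qed
  have P0: "P [] = 0" using P[of 0] p(2) by (simp add: exp_seq_def)
  \<comment> \<open>The sum of all degrees in the support, a crude bound on every single
    exponent.\<close>
  define B where "B = (\<Sum>m\<in>Poly_Mapping.keys p. sum_list (exps (Suc n) m))"
  have sub: "Poly_Mapping.keys p \<subseteq> of_exps ` box (Suc n) B"
  proof
    fix m assume m: "m \<in> Poly_Mapping.keys p"
    have "sum_list (exps (Suc n) m) \<le> B" unfolding B_def using m by (intro member_le_sum) auto
    then have "exps (Suc n) m \<in> box (Suc n) B"
      using member_le_sum_list[of _ "exps (Suc n) m"] by (fastforce simp: box_def)
    moreover have "m = of_exps (exps (Suc n) m)"
      using of_exps_exps[of m "Suc n"] p(1) m by (auto simp: quasisym_def in_vars_def)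
    ultimately show "m \<in> of_exps ` box (Suc n) B" by blast
  qed
  have box: "length c = Suc n" if "c \<in> box (Suc n) B" for c using that by (simp add: box_def)
  have inj: "inj_on of_exps (box (Suc n) B)"
    by (rule inj_on_inverseI[of _ "exps (Suc n)"]) (metis box exps_of_exps)
  have "lin (\<lambda>m. psi q n (map2 (+) a (exps (Suc n) m))) p
    = (\<Sum>m\<in>of_exps ` box (Suc n) B. Poly_Mapping.lookup p m * psi q n (map2 (+) a (exps (Suc n) m)))"
    by (rule lin_superset) (use sub in auto)
  also have "\<dots> = (\<Sum>c\<in>box (Suc n) B. P (nonzero c) * psi q n (map2 (+) a c))"
    unfolding sum.reindex[OF inj] o_def
  proof (intro sum.cong refl)
    fix c assume "c \<in> box (Suc n) B"
    then have c: "length c = Suc n" by (rule box)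
    then have V: "?V (of_exps c)" using keys_of_exps[of c] by simp
    have e: "exps (Suc n) (of_exps c) = c" using exps_of_exps[of c] c by simp
    show "Poly_Mapping.lookup p (of_exps c) * psi q n (map2 (+) a (exps (Suc n) (of_exps c)))
      = P (nonzero c) * psi q n (map2 (+) a c)"
      using P[OF V] exp_seq_eq[OF V] by (simp only: e)
  qed
  also have "\<dots> = 0" by (rule psi_quasisym[where P = P, OF P0 a])
  finally show ?thesis .
qed

text \<open>Exponents of x_1^k times a monomial. Multiplying by x_1 fills up missing degree and
  leaves the evaluation unchanged, since x_1 is sent to 1.\<close>

definition raise_first :: "nat \<Rightarrow> nat list \<Rightarrow> nat list" where
  "raise_first k c = map2 (+) (k # replicate (length c - 1) 0) c"

lemma raise_first_Cons: "raise_first k (x # c) = (k + x) # c"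
  by (simp add: raise_first_def) (rule nth_equalityI, auto)

text \<open>On a generator, x_1^k and each monomial of the cofactor merge into one monomial in front
  of a quasisymmetric polynomial.\<close>

lemma lin_ideal:
  assumes "h \<in> QSym_plus_ideal (Suc n)"
  shows "lin (\<lambda>m. psi q n (raise_first k (exps (Suc n) m))) h = 0"
  using assms
proof induction
  case (gen a p)
  let ?z = "k # replicate n 0"
  have "lin (\<lambda>m. psi q n (raise_first k (exps (Suc n) (\<alpha> + m)))) p = 0" for \<alpha>
  proof -
    have "raise_first k (exps (Suc n) (\<alpha> + m)) = map2 (+) (map2 (+) ?z (exps (Suc n) \<alpha>)) (exps (Suc n) m)" for m
      by (rule nth_equalityI) (auto simp: raise_first_def exps_add)
    then show ?thesis using gen by (simp only: lin_quasisym length_map length_zip length_exps length_Cons length_replicate min.idem)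
  qed
  then show ?case by (simp add: lin_mult)
qed (simp_all add: lin_add)


section \<open>The bracket of a polynomial and its evaluation\<close>

lemma Var_power: "Var i ^ k = (Poly_Mapping.single (Poly_Mapping.single i k) 1 :: 'k::comm_ring_1 mpoly)"
  by (induction k) (simp_all add: Var_def mult_single flip: single_add)

text \<open>\<open>T_perm\<close> and \<open>Sy\<close> choose the same reduced words, so with
  offset 0 the concrete bracket is literally the abstract one; \<open>F_eq_psi\<close> then applies
  to each monomial.\<close>

lemma bracket_eq_lin:
  fixes q :: "'k::field_char_0" and f :: "'k mpoly"
  assumes q: "\<forall>m::nat. m > 0 \<longrightarrow> q ^ m = 1 \<longrightarrow> q = 1"
    and vars: "in_vars (Suc n) f" and hom: "homogeneous n f"
  shows "bracket q (Suc n) f = to_fract (Poly_Mapping.single 0 (lin (\<lambda>m. psi q n (exps (Suc n) m)) f))"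
proof -
  let ?C = "\<lambda>c::'k. to_fract (Poly_Mapping.single 0 c)"
  interpret H: hecke_action ?C "\<lambda>i. to_fract (Var i)" swap_fract q
    by (rule hecke_action_mpoly[OF q])
  have T: "T_op q j = H.T j" for j
    by (rule ext) (simp add: T_op_def H.T_def ddiff_def to_fract_diff)
  have Tw: "T_word q ws G = H.Tw 0 ws G" for ws G
    by (induction ws) (simp_all add: T)
  have D: "to_fract (\<Prod>j=1..n. Poly_Mapping.single 0 q * Var j - Var (j + 1)) = H.Dn 0 (Suc n)"
    by (simp add: H.Dn_def to_fract_prod to_fract_diff to_fract_mult atLeastLessThanSuc_atLeastAtMost)
  have mon: "H.mon a c = to_fract (Poly_Mapping.single (\<Sum>i<length c. Poly_Mapping.single (Suc (a + i)) (c ! i)) 1)" for a c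
  proof (induction c arbitrary: a)
    case (Cons x c)
    show ?case
      unfolding H.mon.simps Cons.IH length_Cons sum.lessThan_Suc_shift
      by (simp add: Var_power mult_single flip: to_fract_power to_fract_mult)
  qed simp
  have mono: "to_fract (Poly_Mapping.single m c) = ?C c * H.mon 0 (exps (Suc n) m)"
    if "Poly_Mapping.keys m \<subseteq> {1..Suc n}" for m c
  proof -
    have "H.mon 0 (exps (Suc n) m) = to_fract (Poly_Mapping.single (of_exps (exps (Suc n) m)) 1)"
      by (simp add: mon of_exps_def)
    then show ?thesis by (simp add: of_exps_exps[OF that] mult_single flip: to_fract_mult)
  qed
  have "bracket q (Suc n) f = H.Sy 0 (Suc n) (to_fract f / H.Dn 0 (Suc n))"
    unfolding bracket_def T_perm_def Tw H.Sy_def diff_Suc_1 D ..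
  also have "to_fract f = (\<Sum>m\<in>Poly_Mapping.keys f. ?C (Poly_Mapping.lookup f m) * H.mon 0 (exps (Suc n) m))"
    by (subst poly_eq_sum_keys[of f], unfold to_fract_sum, intro sum.cong refl mono)
      (use vars in \<open>auto simp: in_vars_def\<close>)
  also have "H.Sy 0 (Suc n) (\<dots> / H.Dn 0 (Suc n))
    = (\<Sum>m\<in>Poly_Mapping.keys f. ?C (Poly_Mapping.lookup f m) * H.F 0 (exps (Suc n) m))"
    unfolding sum_divide_distrib H.Sy_sum by (simp add: H.Sy_C H.F_def flip: times_divide_eq_right)
  also have "\<dots> = (\<Sum>m\<in>Poly_Mapping.keys f. ?C (Poly_Mapping.lookup f m * psi q n (exps (Suc n) m)))"
  proof (intro sum.cong refl)
    fix m assume m: "m \<in> Poly_Mapping.keys f"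
    then have "sum_list (exps (Suc n) m) = n"
      using vars hom sum_exps[of m "Suc n"] by (auto simp: in_vars_def homogeneous_def)
    then show "?C (Poly_Mapping.lookup f m) * H.F 0 (exps (Suc n) m) = ?C (Poly_Mapping.lookup f m * psi q n (exps (Suc n) m))"
      by (simp only: H.F_eq_psi length_exps order.refl H.C_mult)
  qed
  also have "\<dots> = ?C (lin (\<lambda>m. psi q n (exps (Suc n) m)) f)"
    by (simp only: lin_def H.C_sum)
  finally show ?thesis .
qed

lemma ballot_upt:
  "(\<And>i. a \<le> i \<Longrightarrow> i < b \<Longrightarrow> sum_list (map g [i..<b]) \<le> b - Suc i) \<Longrightarrow> ballot (map g [a..<b])"
proof (induction "b - a" arbitrary: a)
  case (Suc k)
  then have ab: "a < b" by simp
  then have "ballot (map g [Suc a..<b])" using Suc by (intro Suc.hyps) auto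
  then show ?case using Suc.prems[of a] ab by (simp add: upt_conv_Cons)
qed simp

lemma ballot_exps:
  assumes "m \<in> ABB (Suc n)"
  shows "ballot (exps (Suc n) m)" "sum_list (exps (Suc n) m) \<le> n"
proof -
  have sum: "sum_list (map (Poly_Mapping.lookup m) [i..<Suc (Suc n)]) = (\<Sum>j=i..Suc n. Poly_Mapping.lookup m j)" for i
    by (simp only: sum_set_upt_conv_sum_list_nat[symmetric] set_upt atLeastLessThanSuc_atLeastAtMost)
  have le: "1 \<le> i \<Longrightarrow> i \<le> Suc n \<Longrightarrow> (\<Sum>j=i..Suc n. Poly_Mapping.lookup m j) \<le> Suc n - i" for i
    using assms by (auto simp: ABB_def)
  show "ballot (exps (Suc n) m)"
    unfolding exps_def by (rule ballot_upt) (simp only: sum, use le in fastforce)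
  show "sum_list (exps (Suc n) m) \<le> n"
    unfolding exps_def sum using le[of 1] by simp
qed

lemma weight_eq_sum: "weight k c = (\<Sum>i<length c. (k + i) * c ! i)"
  by (induction c arbitrary: k) (simp_all add: sum.lessThan_Suc_shift del: sum.lessThan_Suc)

lemma weight_exps: "weight 0 (exps n m) = (\<Sum>i=1..n. (i - 1) * Poly_Mapping.lookup m i)"
proof -
  have "weight 0 (exps n m) = (\<Sum>i<n. i * Poly_Mapping.lookup m (Suc i))"
    by (simp add: weight_eq_sum nth_exps)
  also have "\<dots> = (\<Sum>i=1..n. (i - 1) * Poly_Mapping.lookup m i)"
    by (rule sum.reindex_bij_witness[of _ "\<lambda>i. i - 1" Suc]) auto
  finally show ?thesis .
qed

lemma eval_mpoly_eq_lin:
  fixes q :: "'k::comm_ring_1"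
  assumes "in_vars n g"
  shows "eval_mpoly (\<lambda>i. q ^ (i - 1)) g = lin (\<lambda>m. q ^ weight 0 (exps n m)) g"
  unfolding eval_mpoly_def lin_def
proof (intro sum.cong refl)
  fix m assume "m \<in> Poly_Mapping.keys g"
  then have "Poly_Mapping.keys m \<subseteq> {1..n}" using assms by (auto simp: in_vars_def)
  then have "(\<Prod>i\<in>Poly_Mapping.keys m. (q ^ (i - 1)) ^ Poly_Mapping.lookup m i) = (\<Prod>i=1..n. (q ^ (i - 1)) ^ Poly_Mapping.lookup m i)"
    by (intro prod.mono_neutral_left) (auto simp: in_keys_iff)
  also have "\<dots> = q ^ weight 0 (exps n m)"
    by (simp add: weight_exps power_sum power_mult)
  finally show "Poly_Mapping.lookup g m * (\<Prod>i\<in>Poly_Mapping.keys m. (q ^ (i - 1)) ^ Poly_Mapping.lookup m i)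
      = Poly_Mapping.lookup g m * q ^ weight 0 (exps n m)" by simp
qed

text \<open>Enlarging the first exponent affects only the first ballot inequality, which holds with
  equality once the total degree is n; the weight ignores that exponent.\<close>

lemma psi_raise_first:
  fixes q :: "'k::field"
  assumes nz: "\<And>k. qint q (Suc k) \<noteq> 0" and c: "length c = Suc n" "ballot c"
  shows "psi q n (raise_first k c) = (if sum_list c + k = n then q ^ weight 0 c else 0)"
proof -
  obtain x d where cd: "c = x # d" using c(1) by (cases c) auto
  show ?thesis
  proof (cases "sum_list c + k = n")
    case True
    then have "psi q n (raise_first k c) = q ^ weight 0 (raise_first k c)"
      using c by (intro psi_ballot[OF nz]) (auto simp: cd raise_first_Cons)
    then show ?thesis using True by (simp add: cd raise_first_Cons)
  next
    case False
    then show ?thesis using c by (auto simp: cd raise_first_Cons intro!: psi_degree)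
  qed
qed

text \<open>The sum over k of psi(x_1^k g) is computed twice. A monomial of degree e in g
  contributes only for k = n - e, so the sum is the evaluation of g. Modulo the ideal g may be
  replaced by f, and then only k = 0 survives by degree. This treats all homogeneous components of g
  at once.\<close>

lemma bracket_eq_eval:
  fixes q :: "'k::field_char_0" and f g h :: "'k mpoly"
  assumes q: "\<forall>m::nat. m > 0 \<longrightarrow> q ^ m = 1 \<longrightarrow> q = 1"
    and f: "in_vars (Suc n) f" "homogeneous n f"
    and fgh: "f = g + h" and g: "g \<in> L_space (Suc n)" and h: "h \<in> QSym_plus_ideal (Suc n)"
  shows "bracket q (Suc n) f = to_fract (Poly_Mapping.single 0 (eval_mpoly (\<lambda>i. q ^ (i - 1)) g))"
proof -
  let ?l = "\<lambda>k. lin (\<lambda>m. psi q n (raise_first k (exps (Suc n) m)))"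
  have keys_g: "m \<in> ABB (Suc n)" if "m \<in> Poly_Mapping.keys g" for m
    using g that by (auto simp: L_space_def)
  then have vars_g: "in_vars (Suc n) g" by (auto simp: in_vars_def ABB_def)
  have fg: "?l k f = ?l k g" for k
    using lin_ideal[OF h] by (simp add: fgh lin_add)
  have deg_f: "sum_list (exps (Suc n) m) = n" if "m \<in> Poly_Mapping.keys f" for m
    using f that sum_exps[of m "Suc n"] by (auto simp: in_vars_def homogeneous_def)
  have high: "?l k f = 0" if "k > 0" for k
    unfolding lin_def
  proof (intro sum.neutral ballI)
    fix m assume "m \<in> Poly_Mapping.keys f"
    moreover obtain x d where "exps (Suc n) m = x # d" by (metis length_Suc_conv length_exps)
    ultimately have "sum_list (raise_first k (exps (Suc n) m)) = k + n"
      using deg_f[of m] by (simp add: raise_first_Cons)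
    then show "Poly_Mapping.lookup f m * psi q n (raise_first k (exps (Suc n) m)) = 0"
      using that by (subst psi_degree) (auto simp: raise_first_def)
  qed
  have "eval_mpoly (\<lambda>i. q ^ (i - 1)) g = lin (\<lambda>m. q ^ weight 0 (exps (Suc n) m)) g"
    by (rule eval_mpoly_eq_lin[OF vars_g])
  also have "\<dots> = (\<Sum>k\<le>n. ?l k g)"
    unfolding lin_def sum.swap[of _ _ "{..n}"]
  proof (intro sum.cong refl)
    fix m assume "m \<in> Poly_Mapping.keys g"
    note m = ballot_exps[OF keys_g[OF this]]
    let ?c = "exps (Suc n) m"
    have "(\<Sum>k\<le>n. psi q n (raise_first k ?c)) = (\<Sum>k\<le>n. if k = n - sum_list ?c then q ^ weight 0 ?c else 0)"
      using m(2) psi_raise_first[OF qint_nonzero_of_root_condition[OF q] length_exps m(1)]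
      by (intro sum.cong refl) auto
    also have "\<dots> = q ^ weight 0 ?c" by simp
    finally show "Poly_Mapping.lookup g m * q ^ weight 0 ?c = (\<Sum>k\<le>n. Poly_Mapping.lookup g m * psi q n (raise_first k ?c))"
      by (simp only: sum_distrib_left[symmetric])
  qed
  also have "\<dots> = (\<Sum>k\<le>n. if k = 0 then ?l 0 f else 0)"
    by (intro sum.cong refl) (simp add: fg[symmetric] high)
  also have "\<dots> = ?l 0 f" by simp
  also have "\<dots> = lin (\<lambda>m. psi q n (exps (Suc n) m)) f"
  proof -
    have "raise_first 0 c = c" for c by (cases c) (simp_all add: raise_first_Cons, simp add: raise_first_def)
    then show ?thesis by simp
  qed
  finally show ?thesis using bracket_eq_lin[OF q f] by simp
qed

theorem mainTheorem15:
  fixes q :: "'k::field_char_0" and n :: nat and f g h :: "'k mpoly"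
  assumes q: "\<forall>m::nat. m > 0 \<longrightarrow> q ^ m = 1 \<longrightarrow> q = 1"
    and n: "n \<ge> 1"
    and fvars: "in_vars n f" and fhom: "homogeneous (n - 1) f"
    and fgh: "f = g + h" and g: "g \<in> L_space n" and h: "h \<in> QSym_plus_ideal n"
  shows "bracket q n f = to_fract (Poly_Mapping.single 0 (eval_mpoly (\<lambda>i. q ^ (i - 1)) g))
    \<and> (\<forall>c\<in>ABB n. total_deg c = n - 1 \<longrightarrow>
         bracket q n (Poly_Mapping.single c 1) =
         to_fract (Poly_Mapping.single 0 (q ^ (\<Sum>i=1..n. (i - 1) * Poly_Mapping.lookup c i))))"
proof -
  obtain k where k: "n = Suc k" using n by (cases n) auto
  have "bracket q n (Poly_Mapping.single c 1) =
      to_fract (Poly_Mapping.single 0 (q ^ (\<Sum>i=1..n. (i - 1) * Poly_Mapping.lookup c i)))"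
    if c: "c \<in> ABB n" "total_deg c = n - 1" for c
  proof -
    have vars: "in_vars n (Poly_Mapping.single c (1::'k))"
      using c by (simp add: in_vars_def ABB_def)
    have "bracket q n (Poly_Mapping.single c 1) =
        to_fract (Poly_Mapping.single 0 (eval_mpoly (\<lambda>i. q ^ (i - 1)) (Poly_Mapping.single c 1)))"
      unfolding k
      by (rule bracket_eq_eval[OF q, where h = 0])
        (use c vars in \<open>simp_all add: k homogeneous_def L_space_def QSym_plus_ideal.zero\<close>)
    then show ?thesis by (simp only: eval_mpoly_eq_lin[OF vars] lin_single weight_exps mult_1)
  qed
  moreover have "bracket q n f = to_fract (Poly_Mapping.single 0 (eval_mpoly (\<lambda>i. q ^ (i - 1)) g))"
    using bracket_eq_eval[OF q _ _ fgh] fvars fhom g h unfolding k by simp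
  ultimately show ?thesis by blast
qed

end
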